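(* There is a sequence of real numbers $(\delta_k)_{k\ge1}$ with $\delta_k\to0$ as $k\to\infty$ such that, for all $k$, $$\log\epsilon_k\le 2^k\log(C+\delta_k),$$ where $\epsilon_k$ and $C$ are as defined in the context. (Informally: $\log\epsilon_k\le 2^k\log(C+o(1))$.)
   Context: For a positive integer $n$, $\Phi_n(x)=\prod_{1\le j\le n,\ (j,n)=1}(x-e^{2\pi i j/n})=\sum_{m=0}^{\varphi(n)}a_n(m)x^m$ is the $n$-th cyclotomic polynomial, $A_n=\max_m|a_n(m)|$ and $S_n=\sum_{m=0}^{\varphi(n)}|a_n(m)|$. For distinct odd primes $p_1<p_2<\dots<p_k$ put $M_k=M_k(p_1,\dots,p_k)=\prod_{i=1}^{k-2}p_i^{2^{k-i-1}-1}$ (an empty product is $1$). $\epsilon_k$ denotes the smallest positive real number such that $A_{p_1\cdots p_k}\le\epsilon_kM_k$ for all odd primes $p_1<\dots<p_k$. Let $$d=\sup_{p<q<r\ \text{odd primes}}\frac{S_{pqr}}{p^2qr},\qquad \rho=\prod_{i=0}^{\infty}\Big(\frac{2i+5}{2i+6}\Big)^{1/2^i},\qquad C=\Big(\tfrac34\,\epsilon_3^{3/2}\,d\,\rho^{1/4}\Big)^{1/32}.$$ *)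

theory Defs
  imports "HOL-Analysis.Analysis" "HOL-Computational_Algebra.Polynomial" "HOL-Number_Theory.Totient"
begin

definition cyclo :: "nat \<Rightarrow> complex poly" where
  "cyclo n = (\<Prod>j\<in>{j\<in>{1..n}. coprime j n}. [:- cis (2 * pi * real j / real n), 1:])"

definition cyc_height :: "nat \<Rightarrow> real" where
  "cyc_height n = Max ((\<lambda>m. cmod (coeff (cyclo n) m)) ` {0..totient n})"

definition cyc_length :: "nat \<Rightarrow> real" where
  "cyc_length n = (\<Sum>m\<in>{0..totient n}. cmod (coeff (cyclo n) m))"

definition odd_prime_tuple :: "nat \<Rightarrow> (nat \<Rightarrow> nat) \<Rightarrow> bool" where
  "odd_prime_tuple k p \<longleftrightarrow> (\<forall>i\<in>{1..k}. prime (p i) \<and> odd (p i)) \<and>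
     (\<forall>i\<in>{1..k}. \<forall>j\<in>{1..k}. i < j \<longrightarrow> p i < p j)"

definition Mk :: "nat \<Rightarrow> (nat \<Rightarrow> nat) \<Rightarrow> real" where
  "Mk k p = (\<Prod>i\<in>{1..k-2}. real (p i) ^ (2 ^ (k - i - 1) - 1))"

text \<open>Smallest positive eps with A_{p_1...p_k} <= eps M_k for all tuples: the supremum of the ratios.\<close>
definition eps :: "nat \<Rightarrow> real" where
  "eps k = Sup {cyc_height (\<Prod>i\<in>{1..k}. p i) / Mk k p | p. odd_prime_tuple k p}"

definition dconst :: real where
  "dconst = Sup {cyc_length (p*q*r) / (real p ^ 2 * real q * real r) | p q r.
      prime p \<and> prime q \<and> prime r \<and> odd p \<and> p < q \<and> q < r}"

definition rho :: real where
  "rho = (\<Prod>i. ((2 * real i + 5) / (2 * real i + 6)) powr (1 / 2 ^ i))"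

definition Cconst :: real where
  "Cconst = (3/4 * eps 3 powr (3/2) * dconst * rho powr (1/4)) powr (1/32)"

end

theory Submission
  imports Defs "HOL-Real_Asymp.Real_Asymp"
begin

text \<open>
  Let \<open>n\<close> be a product of odd primes, \<open>s\<close> a prime not dividing \<open>n\<close>, and
  \<open>\<Psi>\<^sub>n = (1 - x^n) / \<Phi>\<^sub>n\<close>. The identity
  \<open>\<Phi>\<^sub>n\<^sub>s(x) = \<Phi>\<^sub>n(x^s) \<Psi>\<^sub>n(x) / (1 - x^n)\<close> expresses a coefficient of \<open>\<Phi>\<^sub>n\<^sub>s\<close> as a sum over
  exponents \<open>l n + i s + j\<close>. For fixed \<open>j\<close> at most one pair \<open>(l, i)\<close> contributes, so heights grow at
  most by the factor \<open>W\<close>, the length of \<open>\<Psi>\<^sub>n\<close>. Since all exponents are at most \<open>\<phi>(n s)\<close> and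
  \<open>\<Phi>\<^sub>n\<close> is palindromic, \<open>l\<close> takes about \<open>s / 2\<close> values on average, so \<open>S\<^sub>n\<^sub>s \<le> S\<^sub>n W s / 2\<close>. From
  \<open>\<Psi>\<^sub>n\<^sub>s(x) = \<Phi>\<^sub>n(x) \<Psi>\<^sub>n(x^s)\<close>, \<open>W\<close> is at most twice the product of the preceding lengths.
  Together with \<open>S\<^sub>p\<^sub>q \<le> p q / 2\<close> these recursions give
  \<open>\<epsilon>\<^sub>k \<le> \<epsilon>\<^sub>3 2^(k-4) (d/2)^(2^(k-4) - 1)\<close> for \<open>k \<ge> 4\<close>, hence the limit superior of
  \<open>\<epsilon>\<^sub>k^(1/2^k)\<close> is at most \<open>(d/2)^(1/16)\<close>. This is at most \<open>C\<close> because \<open>d \<le> \<epsilon>\<^sub>3\<close>,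
  \<open>\<epsilon>\<^sub>3 \<ge> 1/3\<close> and \<open>\<rho> \<ge> 25/36\<close>.
\<close>

section \<open>Cyclotomic polynomials and primitive roots of unity\<close>

text \<open>The roots of exact order n, described by divisibility instead of an index j, so that
  powers and inverses of roots can be handled by divisibility arguments.\<close>

definition primitive_roots :: "nat \<Rightarrow> complex set" where
  "primitive_roots n = {z. z ^ n = 1 \<and> (\<forall>d. z ^ d = 1 \<longrightarrow> n dvd d)}"

lemma cis_root_power_eq_1_iff:
  assumes "n > 0"
  shows "cis (2 * pi * real j / real n) ^ d = 1 \<longleftrightarrow> n dvd j * d"
proof -
  have "cis (2 * pi * real j / real n) ^ d = exp (2 * of_real pi * \<i> * of_nat (j * d) / of_nat n)"
    by (simp add: cis_conv_exp exp_of_nat_mult[symmetric] mult_ac)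
  then show ?thesis
    using complex_root_unity_eq_1[of n "j * d"] assms by simp
qed

lemma bij_betw_primitive_roots:
  assumes n: "n > 0"
  shows "bij_betw (\<lambda>j. cis (2 * pi * real j / real n)) (totatives n) (primitive_roots n)"
proof -
  let ?f = "\<lambda>j. cis (2 * pi * real j / real n)"
  have inj: "inj_on ?f {..<n}"
    using Complex.bij_betw_roots_unity[OF n] by (simp add: bij_betw_def)
  have "inj_on ?f (totatives n)"
  proof (cases "n = 1")
    case False
    then have "totatives n \<subseteq> {..<n}"
      using n totatives_less[of _ n] by auto
    then show ?thesis using inj inj_on_subset by blast
  qed simp
  moreover have "?f ` totatives n = primitive_roots n"
  proof (intro equalityI subsetI)
    fix z assume "z \<in> ?f ` totatives n"
    then obtain j where j: "j \<in> totatives n" "z = ?f j" by auto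
    then have "coprime n j" by (simp add: in_totatives_iff coprime_commute)
    then have "n dvd j * d \<longleftrightarrow> n dvd d" for d
      by (rule coprime_dvd_mult_right_iff)
    moreover have "z ^ d = 1 \<longleftrightarrow> n dvd j * d" for d
      unfolding j(2) by (rule cis_root_power_eq_1_iff[OF n])
    ultimately show "z \<in> primitive_roots n"
      unfolding primitive_roots_def by simp
  next
    fix z assume z: "z \<in> primitive_roots n"
    then have "z \<in> ?f ` {..<n}"
      using Complex.bij_betw_roots_unity[OF n] by (auto simp: bij_betw_def primitive_roots_def)
    then obtain k where k: "k < n" "z = ?f k" by auto
    have "coprime k n"
    proof -
      \<comment> \<open>With g = \<open>gcd k n\<close>, the power z^(n/g) is already 1, so exact
        order n forces g = 1.\<close>
      obtain a b where ab: "k = gcd k n * a" "n = gcd k n * b"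
        by (meson dvdE gcd_dvd1 gcd_dvd2)
      have "n * a = k * b" using ab by (metis mult.assoc mult.commute)
      then have "z ^ b = 1"
        using k(2) cis_root_power_eq_1_iff[OF n] by (metis dvd_triv_left)
      then have "n dvd b" using z by (simp add: primitive_roots_def)
      then have "gcd k n * b \<le> b" using ab(2) n by (metis dvd_imp_le gr_zeroI mult_0_right)
      moreover have "b > 0" using ab(2) n by (metis gr_zeroI mult_0_right)
      ultimately have "gcd k n = 1"
        using n by (simp add: le_Suc_eq)
      then show ?thesis by (simp add: coprime_iff_gcd_eq_1)
    qed
    show "z \<in> ?f ` totatives n"
    \<comment> \<open>Totatives lie in 1..n, whereas k lies in 0..n-1. The index k = 0 occurs only
      for n = 1, and there j = 1 represents it.\<close>
    proof (cases "k = 0")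
      case True
      then have "n = 1" using \<open>coprime k n\<close> by simp
      then show ?thesis using True k(2) by (auto simp: cis.ctr one_complex.ctr)
    next
      case False
      then show ?thesis using k \<open>coprime k n\<close> by (auto simp: in_totatives_iff)
    qed
  qed
  ultimately show ?thesis by (simp add: bij_betw_def)
qed

lemma finite_primitive_roots: "n > 0 \<Longrightarrow> finite (primitive_roots n)"
  using bij_betw_finite[OF bij_betw_primitive_roots] by simp

lemma card_primitive_roots: "n > 0 \<Longrightarrow> card (primitive_roots n) = totient n"
  using bij_betw_same_card[OF bij_betw_primitive_roots] by (simp add: totient_def)

lemma cyclo_eq_prod_primitive_roots:
  assumes "n > 0"
  shows "cyclo n = (\<Prod>z\<in>primitive_roots n. [:- z, 1:])"
proof -
  have "{j\<in>{1..n}. coprime j n} = totatives n"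
    by (auto simp: totatives_def)
  then show ?thesis
    unfolding cyclo_def
    using prod.reindex_bij_betw[OF bij_betw_primitive_roots[OF assms], of "\<lambda>z. [:- z, 1:]"]
    by simp
qed

lemma degree_cyclo: "n > 0 \<Longrightarrow> degree (cyclo n) = totient n"
  by (simp add: cyclo_eq_prod_primitive_roots degree_prod_eq_sum_degree card_primitive_roots)

lemma lead_coeff_cyclo: "n > 0 \<Longrightarrow> lead_coeff (cyclo n) = 1"
  by (simp add: cyclo_eq_prod_primitive_roots lead_coeff_prod)

lemma poly_cyclo_eq_0_iff: "n > 0 \<Longrightarrow> poly (cyclo n) z = 0 \<longleftrightarrow> z \<in> primitive_roots n"
  by (simp add: cyclo_eq_prod_primitive_roots poly_prod finite_primitive_roots)

lemma cyclo_1: "cyclo 1 = [:-1, 1:]"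
proof -
  have "{j\<in>{1..1::nat}. coprime j 1} = {1}" by auto
  then show ?thesis by (simp add: cyclo_def)
qed

text \<open>Both sides are monic of degree \<open>s * totient n\<close> and vanish at the primitive
  roots of orders n and n s. There are \<open>totient (n * s) + totient n\<close> such points, as
  many as the degree, so the polynomials agree.\<close>

lemma cyclo_pcompose_prime:
  assumes n: "n > 0" and s: "prime s" and ns: "\<not> s dvd n"
  shows "cyclo n \<circ>\<^sub>p monom 1 s = cyclo (n * s) * cyclo n"
proof -
  have s0: "s > 0" using s prime_gt_0_nat by blast
  have ns0: "n * s > 0" using n s0 by simp
  have cop: "coprime n s" using s ns prime_imp_coprime coprime_commute by blast
  let ?A = "primitive_roots (n * s) \<union> primitive_roots n"
  have disj: "primitive_roots (n * s) \<inter> primitive_roots n = {}"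
  proof -
    have "\<not> n * s dvd n"
      using n prime_gt_1_nat[OF s] by (auto dest!: dvd_imp_le)
    then show ?thesis by (auto simp: primitive_roots_def)
  qed
  have tot: "totient (n * s) + totient n = s * totient n"
    using totient_mult_coprime[OF cop] totient_prime[OF s] s0
    by (cases s) simp_all
  have "card ?A = s * totient n"
    using card_Un_disjoint[OF finite_primitive_roots[OF ns0] finite_primitive_roots[OF n] disj]
      card_primitive_roots[OF n] card_primitive_roots[OF ns0] tot by simp
  moreover have d1: "degree (cyclo n \<circ>\<^sub>p monom 1 s) = s * totient n"
    by (simp add: degree_pcompose degree_cyclo n degree_monom_eq)
  moreover have d2: "degree (cyclo (n * s) * cyclo n) = s * totient n"
  proof -
    have "cyclo (n * s) \<noteq> 0" "cyclo n \<noteq> 0"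
      using lead_coeff_cyclo[OF n] lead_coeff_cyclo[OF ns0] by auto
    then show ?thesis using tot degree_cyclo n ns0 by (simp add: degree_mult_eq)
  qed
  moreover have "lead_coeff (cyclo n \<circ>\<^sub>p monom 1 s) = lead_coeff (cyclo (n * s) * cyclo n)"
    using s0 by (simp add: lead_coeff_comp degree_monom_eq lead_coeff_mult
        lead_coeff_cyclo[OF n, unfolded One_nat_def] lead_coeff_cyclo[OF ns0, unfolded One_nat_def])
  moreover have "poly (cyclo n \<circ>\<^sub>p monom 1 s) z = poly (cyclo (n * s) * cyclo n) z" if "z \<in> ?A" for z
  proof -
    have "n dvd s * d \<longleftrightarrow> n dvd d" for d
      using cop by (rule coprime_dvd_mult_right_iff)
    moreover have "n * s dvd s * d \<longleftrightarrow> n dvd d" for d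
      using s0 by (metis mult.commute nat_mult_dvd_cancel1)
    moreover have "(z ^ s) ^ n = 1"
      using that unfolding primitive_roots_def
      by (auto simp: mult.commute simp flip: power_mult) (metis power_mult power_one mult.commute)
    ultimately have "z ^ s \<in> primitive_roots n"
      using that unfolding primitive_roots_def by (auto simp flip: power_mult)
    then have "poly (cyclo n) (z ^ s) = 0"
      by (simp add: poly_cyclo_eq_0_iff n)
    moreover have "poly (cyclo (n * s)) z = 0 \<or> poly (cyclo n) z = 0"
      using that poly_cyclo_eq_0_iff[OF n] poly_cyclo_eq_0_iff[OF ns0] by auto
    ultimately show ?thesis
      by (auto simp: poly_pcompose poly_monom)
  qed
  ultimately show ?thesis
    by (intro poly_eqI_degree_lead_coeff[where n = "s * totient n" and A = ?A]) auto
qed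

text \<open>Inversion permutes the primitive roots, so reversing the coefficients multiplies
  \<open>cyclo n\<close> by a constant of modulus 1. Working with moduli avoids determining that
  constant.\<close>

lemma norm_coeff_cyclo_reverse:
  assumes n: "n > 1" and i: "i \<le> totient n"
  shows "cmod (coeff (cyclo n) (totient n - i)) = cmod (coeff (cyclo n) i)"
proof -
  have n0: "n > 0" using n by simp
  let ?U = "primitive_roots n"
  have nz: "z \<noteq> 0" "cmod z = 1" if "z \<in> ?U" for z
  proof -
    from that have "z ^ n = 1" by (simp add: primitive_roots_def)
    then show "cmod z = 1" "z \<noteq> 0"
      using n0 by (auto simp: power_0_left dest: power_eq_1_iff)
  qed
  have inv: "inverse z \<in> ?U" if "z \<in> ?U" for z
    using that by (simp add: primitive_roots_def power_inverse)
  have bij: "bij_betw inverse ?U ?U"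
    by (rule bij_betw_byWitness[where f' = inverse]) (use inv in auto)
  have refl: "reflect_poly [:- z, 1:] = smult (- z) [:- inverse z, 1:]" if "z \<in> ?U" for z
    using nz[OF that] by (simp add: reflect_poly_def)
  have "reflect_poly (cyclo n) = (\<Prod>z\<in>?U. smult (- z) [:- inverse z, 1:])"
    unfolding cyclo_eq_prod_primitive_roots[OF n0] reflect_poly_prod
    using refl by (intro prod.cong) auto 
  also have "\<dots> = smult (\<Prod>z\<in>?U. - z) (\<Prod>z\<in>?U. [:- inverse z, 1:])"
    by (rule prod_smult)
  also have "(\<Prod>z\<in>?U. [:- inverse z, 1:]) = cyclo n"
    using prod.reindex_bij_betw[OF bij, of "\<lambda>z. [:- z, 1:]"] cyclo_eq_prod_primitive_roots[OF n0]
    by simp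
  finally have "coeff (reflect_poly (cyclo n)) i = (\<Prod>z\<in>?U. - z) * coeff (cyclo n) i"
    by simp
  moreover have "coeff (reflect_poly (cyclo n)) i = coeff (cyclo n) (totient n - i)"
    using i by (simp add: coeff_reflect_poly degree_cyclo n0)
  moreover have "cmod (\<Prod>z\<in>?U. - z) = 1"
    using nz by (simp flip: prod_norm)
  ultimately show ?thesis by (simp add: norm_mult)
qed

section \<open>Length of a polynomial\<close>

definition plen :: "'a::real_normed_field poly \<Rightarrow> real" where
  "plen p = (\<Sum>i\<le>degree p. norm (coeff p i))"

lemma plen_eq_sum:
  assumes "degree p \<le> n"
  shows "plen p = (\<Sum>i\<le>n. norm (coeff p i))"
  unfolding plen_def by (rule sum.mono_neutral_left) (use assms in \<open>auto simp: coeff_eq_0\<close>)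

lemma plen_nonneg: "plen p \<ge> 0"
  by (simp add: plen_def sum_nonneg)

lemma plen_0 [simp]: "plen 0 = 0"
  by (simp add: plen_def)

lemma plen_minus [simp]: "plen (- p) = plen p"
  by (simp add: plen_def)

lemma plen_monom [simp]: "plen (monom c n) = norm c"
proof -
  have "plen (monom c n) = (\<Sum>i\<le>n. norm (coeff (monom c n) i))"
    by (rule plen_eq_sum) (simp add: degree_monom_le)
  also have "\<dots> = (\<Sum>i\<le>n. if i = n then norm c else 0)"
    by (intro sum.cong) auto
  finally show ?thesis by simp
qed

lemma plen_add_le: "plen (p + q) \<le> plen p + plen q"
proof -
  let ?n = "max (degree p) (degree q)"
  have "plen (p + q) = (\<Sum>i\<le>?n. norm (coeff p i + coeff q i))"
    using plen_eq_sum[OF degree_add_le_max] by simp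
  also have "\<dots> \<le> (\<Sum>i\<le>?n. norm (coeff p i) + norm (coeff q i))"
    by (intro sum_mono norm_triangle_ineq)
  also have "\<dots> = plen p + plen q"
    using plen_eq_sum[of p ?n] plen_eq_sum[of q ?n] by (simp add: sum.distrib)
  finally show ?thesis .
qed

lemma plen_sum_le: "plen (\<Sum>i\<in>A. f i) \<le> (\<Sum>i\<in>A. plen (f i))"
proof (induction A rule: infinite_finite_induct)
  case (insert x F)
  then show ?case using plen_add_le[of "f x" "sum f F"] by simp
qed auto

lemma plen_monom_mult: "plen (monom c k * p) = norm c * plen p"
proof -
  have "degree (monom c k * p) \<le> k + degree p"
    by (metis add_mono degree_mult_le degree_monom_le le_trans order_refl)
  then have "plen (monom c k * p) = (\<Sum>i\<le>k + degree p. norm (coeff (monom c k * p) i))"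
    by (rule plen_eq_sum)
  also have "\<dots> = (\<Sum>i\<in>(+) k ` {..degree p}. norm (coeff (monom c k * p) i))"
  proof (rule sum.mono_neutral_right)
    have "(+) k ` {..degree p} = {k..k + degree p}"
      using image_add_atLeastAtMost[of k 0 "degree p"] by (simp add: atMost_atLeast0)
    then show "\<forall>i\<in>{..k + degree p} - (+) k ` {..degree p}. norm (coeff (monom c k * p) i) = 0"
      by (auto simp: coeff_monom_mult)
  qed auto
  also have "\<dots> = (\<Sum>i\<le>degree p. norm c * norm (coeff p i))"
    by (subst sum.reindex) (auto simp: coeff_monom_mult norm_mult)
  finally show ?thesis by (simp add: plen_def sum_distrib_left)
qed

lemma plen_mult_le: "plen (p * q) \<le> plen p * plen q"
proof -
  have "p * q = (\<Sum>i\<le>degree p. monom (coeff p i) i * q)"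
    by (simp add: poly_as_sum_of_monoms flip: sum_distrib_right)
  then have "plen (p * q) \<le> (\<Sum>i\<le>degree p. plen (monom (coeff p i) i * q))"
    using plen_sum_le[of "\<lambda>i. monom (coeff p i) i * q"] by simp
  also have "\<dots> = plen p * plen q"
    by (simp add: plen_monom_mult plen_def[of p] sum_distrib_right)
  finally show ?thesis .
qed

lemma pcompose_monom_eq_sum:
  fixes p :: "'a::comm_semiring_1 poly"
  shows "p \<circ>\<^sub>p monom 1 s = (\<Sum>i\<le>degree p. monom (coeff p i) (i * s))"
proof -
  have m: "monom a i \<circ>\<^sub>p monom 1 s = monom a (i * s)" for a :: 'a and i
    by (induction i) (simp_all add: monom_Suc pcompose_pCons mult_monom monom_0)
  have "p \<circ>\<^sub>p monom 1 s = (\<Sum>i\<le>degree p. monom (coeff p i) i) \<circ>\<^sub>p monom 1 s"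
    by (simp add: poly_as_sum_of_monoms)
  then show ?thesis by (simp add: pcompose_sum m)
qed

lemma plen_pcompose_monom_le: "plen (p \<circ>\<^sub>p monom 1 s) \<le> plen p"
proof -
  have "plen (p \<circ>\<^sub>p monom 1 s) \<le> (\<Sum>i\<le>degree p. plen (monom (coeff p i) (i * s)))"
    unfolding pcompose_monom_eq_sum by (rule plen_sum_le)
  then show ?thesis by (simp add: plen_def[of p])
qed

section \<open>Coefficients of a quotient by 1 - x^n\<close>

text \<open>Formally c = f(x^s) g(x) (1 + x^n + x^(2n) + ...), so the coefficient at m collects the
  triples with l n + i s + j = m. As n > 0, a cutoff \<open>L\<close> with \<open>m \<le> L\<close>
  captures every l.\<close>

lemma norm_coeff_quotient_le:
  fixes c f g :: "'a::real_normed_field poly"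
  assumes n: "n > 0" and eq: "c * (1 - monom 1 n) = (f \<circ>\<^sub>p monom 1 s) * g" and m: "m \<le> L"
  shows "norm (coeff c m) \<le> (\<Sum>l\<le>L. \<Sum>i\<le>degree f. \<Sum>j\<le>degree g.
     if l * n + i * s + j = m then norm (coeff f i) * norm (coeff g j) else 0)"
proof -
  let ?q = "(f \<circ>\<^sub>p monom 1 s) * g"
  \<comment> \<open>Differences of \<open>h\<close> are coefficients of \<open>?q\<close>, so a
    telescoping sum replaces the geometric series.\<close>
  define h where "h l = (if l * n \<le> m then coeff c (m - l * n) else 0)" for l
  have q: "coeff ?q t = coeff c t - (if t < n then 0 else coeff c (t - n))" for t
    unfolding eq[symmetric] by (simp add: right_diff_distrib coeff_monom_mult mult.commute[of c])
  have h: "h l - h (Suc l) = (if l * n \<le> m then coeff ?q (m - l * n) else 0)" for l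
    unfolding h_def q by (auto simp: not_less algebra_simps)
  have "Suc L * n > m"
    using m n by (metis le_imp_less_Suc less_le_trans mult.right_neutral mult_le_mono2 Suc_leI One_nat_def)
  then have "coeff c m = h 0 - h (Suc L)"
    by (simp add: h_def)
  also have "\<dots> = (\<Sum>l\<le>L. h l - h (Suc l))"
    by (rule sum_telescope[symmetric])
  finally have cm: "coeff c m = (\<Sum>l\<le>L. if l * n \<le> m then coeff ?q (m - l * n) else 0)"
    by (simp add: h)
  have cq: "coeff ?q t = (\<Sum>i\<le>degree f. \<Sum>j\<le>degree g.
     if i * s + j = t then coeff f i * coeff g j else 0)" for t
  proof -
    have "?q = (\<Sum>i\<le>degree f. monom (coeff f i) (i * s)) * (\<Sum>j\<le>degree g. monom (coeff g j) j)"
      by (simp add: pcompose_monom_eq_sum poly_as_sum_of_monoms)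
    also have "\<dots> = (\<Sum>i\<le>degree f. \<Sum>j\<le>degree g. monom (coeff f i * coeff g j) (i * s + j))"
      by (simp add: sum_product mult_monom)
    finally show ?thesis by (simp add: coeff_sum)
  qed
  have "norm (coeff c m) \<le> (\<Sum>l\<le>L. norm (if l * n \<le> m then coeff ?q (m - l * n) else 0))"
    unfolding cm by (rule norm_sum)
  also have "\<dots> \<le> (\<Sum>l\<le>L. \<Sum>i\<le>degree f. \<Sum>j\<le>degree g.
     if l * n + i * s + j = m then norm (coeff f i) * norm (coeff g j) else 0)"
  proof (rule sum_mono)
    fix l
    show "norm (if l * n \<le> m then coeff ?q (m - l * n) else 0) \<le> (\<Sum>i\<le>degree f. \<Sum>j\<le>degree g.
       if l * n + i * s + j = m then norm (coeff f i) * norm (coeff g j) else 0)"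
    proof (cases "l * n \<le> m")
      case True
      have "norm (coeff ?q (m - l * n)) \<le> (\<Sum>i\<le>degree f. \<Sum>j\<le>degree g.
         norm (if i * s + j = m - l * n then coeff f i * coeff g j else 0))"
        unfolding cq by (intro sum_norm_le norm_sum)
      also have "\<dots> = (\<Sum>i\<le>degree f. \<Sum>j\<le>degree g.
         if l * n + i * s + j = m then norm (coeff f i) * norm (coeff g j) else 0)"
        using True by (intro sum.cong refl) (auto simp: norm_mult)
      finally show ?thesis using True by simp
    qed (auto intro!: sum_nonneg)
  qed
  finally show ?thesis .
qed

text \<open>Given m and j, coprimality of s and n determines i modulo n, then
  \<open>degree f < n\<close> fixes i, and hence l. So each coefficient of \<open>g\<close> enters
  at most once, with weight at most \<open>A\<close>.\<close>

lemma norm_coeff_quotient_le_plen: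
  fixes c f g :: "'a::real_normed_field poly"
  assumes n: "n > 0" and eq: "c * (1 - monom 1 n) = (f \<circ>\<^sub>p monom 1 s) * g"
    and cop: "coprime s n" and deg: "degree f < n" and A: "\<And>i. norm (coeff f i) \<le> A"
  shows "norm (coeff c m) \<le> A * plen g"
proof -
  have A0: "A \<ge> 0" using A[of 0] norm_ge_zero order_trans by blast
  let ?I = "{..m} \<times> {..degree f}"
  have one: "(\<Sum>(l, i)\<in>?I. if l * n + i * s + j = m then 1 else 0) \<le> (1::real)" for j
  proof -
    let ?S = "{x\<in>?I. fst x * n + snd x * s + j = m}"
    have "x = y" if "x \<in> ?S" "y \<in> ?S" for x y
    proof -
      have e: "fst x * n + snd x * s = fst y * n + snd y * s" using that by auto
      then have "[snd x * s = snd y * s] (mod n)"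
        by (metis cong_add_lcancel_0_nat cong_def mod_mult_self3)
      then have "[snd x = snd y] (mod n)"
        using cop cong_mult_rcancel_nat by blast
      moreover have "snd x < n" "snd y < n" using that deg by auto
      ultimately have "snd x = snd y" by (simp add: cong_less_modulus_unique_nat)
      moreover from this have "fst x = fst y" using e n by simp
      ultimately show "x = y" by (simp add: prod_eq_iff)
    qed
    then have "card ?S \<le> Suc 0"
      by (subst card_le_Suc0_iff_eq) auto
    moreover have "(\<Sum>(l, i)\<in>?I. if l * n + i * s + j = m then 1 else 0) = real (card ?S)"
      by (simp add: case_prod_unfold flip: sum.inter_filter)
    ultimately show ?thesis by simp
  qed
  have "norm (coeff c m) \<le> (\<Sum>l\<le>m. \<Sum>i\<le>degree f. \<Sum>j\<le>degree g.
     if l * n + i * s + j = m then norm (coeff f i) * norm (coeff g j) else 0)"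
    by (rule norm_coeff_quotient_le[OF n eq order_refl])
  also have "\<dots> \<le> (\<Sum>l\<le>m. \<Sum>i\<le>degree f. \<Sum>j\<le>degree g.
     A * norm (coeff g j) * (if l * n + i * s + j = m then 1 else 0))"
    by (intro sum_mono) (auto intro: mult_right_mono A)
  also have "\<dots> = (\<Sum>j\<le>degree g. A * norm (coeff g j) *
      (\<Sum>(l, i)\<in>?I. if l * n + i * s + j = m then 1 else 0))"
  proof -
    have "(\<Sum>l\<le>m. \<Sum>i\<le>degree f. \<Sum>j\<le>degree g. h l i j) =
        (\<Sum>j\<le>degree g. \<Sum>(l, i)\<in>?I. h l i j)" for h :: "nat \<Rightarrow> nat \<Rightarrow> nat \<Rightarrow> real"
    proof -
      have "(\<Sum>l\<le>m. \<Sum>i\<le>degree f. \<Sum>j\<le>degree g. h l i j) = (\<Sum>l\<le>m. \<Sum>j\<le>degree g. \<Sum>i\<le>degree f. h l i j)"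
        by (intro sum.cong refl sum.swap)
      also have "\<dots> = (\<Sum>j\<le>degree g. \<Sum>l\<le>m. \<Sum>i\<le>degree f. h l i j)"
        by (rule sum.swap)
      finally show ?thesis by (simp add: sum.cartesian_product)
    qed
    then show ?thesis
      by (simp add: sum_distrib_left case_prod_unfold)
  qed
  also have "\<dots> \<le> (\<Sum>j\<le>degree g. A * norm (coeff g j) * 1)"
    using A0 by (intro sum_mono mult_left_mono one mult_nonneg_nonneg) auto
  finally show ?thesis by (simp add: plen_def sum_distrib_left)
qed

text \<open>Summing over m turns the equation into l n + i s + j \<le> K, and discarding j leaves at
  most (K - i s)/n + 1 values of l. The dependence on i is kept so that it can be averaged
  later.\<close>

lemma sum_norm_coeff_quotient_le:
  fixes c f g :: "'a::real_normed_field poly"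
  assumes n: "n > 0" and eq: "c * (1 - monom 1 n) = (f \<circ>\<^sub>p monom 1 s) * g"
    and K: "degree f * s \<le> K + n"
  shows "(\<Sum>m\<le>K. norm (coeff c m)) \<le>
    plen g * (\<Sum>i\<le>degree f. norm (coeff f i) * ((real K - real i * real s) / real n + 1))"
proof -
  have count: "(\<Sum>m\<le>K. \<Sum>l\<le>K. if l * n + i * s + j = m then 1 else 0)
      \<le> (real K - real i * real s) / real n + 1" if i: "i \<le> degree f" for i j
  proof -
    have "(\<Sum>m\<le>K. \<Sum>l\<le>K. if l * n + i * s + j = m then 1 else 0)
        = (\<Sum>l\<le>K. if l * n + i * s + j \<le> K then 1 else (0::real))"
      by (subst sum.swap) (simp add: sum.delta)
    also have "\<dots> = real (card {l\<in>{..K}. l * n + i * s + j \<le> K})"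
      by (simp flip: sum.inter_filter)
    also have "\<dots> \<le> (real K - real i * real s) / real n + 1"
    proof (cases "i * s \<le> K")
      case True
      have "{l\<in>{..K}. l * n + i * s + j \<le> K} \<subseteq> {..(K - i * s) div n}"
        using n by (auto simp: less_eq_div_iff_mult_less_eq)
      then have "card {l\<in>{..K}. l * n + i * s + j \<le> K} \<le> card {..(K - i * s) div n}"
        by (intro card_mono) auto
      then have "real (card {l\<in>{..K}. l * n + i * s + j \<le> K}) \<le> real ((K - i * s) div n) + 1"
        by simp
      also have "real ((K - i * s) div n) \<le> real (K - i * s) / real n"
        by (rule of_nat_div_le_of_nat)
      finally show ?thesis using True by (simp add: of_nat_diff)
    next
      case False
      \<comment> \<open>No l is counted here, but the estimate must still be nonnegative; this is
        where the assumption \<open>K\<close> enters.\<close>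
      have "i * s \<le> K + n" using K i by (meson mult_le_mono1 order_trans)
      then have "real i * real s \<le> real K + real n"
        by (metis of_nat_add of_nat_le_iff of_nat_mult)
      then have "(real K - real i * real s) / real n + 1 \<ge> 0"
        using n by (simp add: field_simps)
      moreover have "{l\<in>{..K}. l * n + i * s + j \<le> K} = {}" using False by auto
      ultimately show ?thesis by (simp only: card.empty of_nat_0)
    qed
    finally show ?thesis .
  qed
  have "(\<Sum>m\<le>K. norm (coeff c m)) \<le> (\<Sum>m\<le>K. \<Sum>l\<le>K. \<Sum>i\<le>degree f. \<Sum>j\<le>degree g.
     if l * n + i * s + j = m then norm (coeff f i) * norm (coeff g j) else 0)"
    by (intro sum_mono norm_coeff_quotient_le[OF n eq]) auto
  also have "\<dots> = (\<Sum>m\<le>K. \<Sum>i\<le>degree f. \<Sum>l\<le>K. \<Sum>j\<le>degree g.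
     if l * n + i * s + j = m then norm (coeff f i) * norm (coeff g j) else 0)"
    by (intro sum.cong refl sum.swap)
  also have "\<dots> = (\<Sum>i\<le>degree f. \<Sum>m\<le>K. \<Sum>l\<le>K. \<Sum>j\<le>degree g.
     if l * n + i * s + j = m then norm (coeff f i) * norm (coeff g j) else 0)"
    by (rule sum.swap)
  also have "\<dots> = (\<Sum>i\<le>degree f. \<Sum>m\<le>K. \<Sum>j\<le>degree g. \<Sum>l\<le>K.
     if l * n + i * s + j = m then norm (coeff f i) * norm (coeff g j) else 0)"
    by (intro sum.cong refl sum.swap)
  also have "\<dots> = (\<Sum>i\<le>degree f. \<Sum>j\<le>degree g. \<Sum>m\<le>K. \<Sum>l\<le>K.
     if l * n + i * s + j = m then norm (coeff f i) * norm (coeff g j) else 0)"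
    by (intro sum.cong refl sum.swap)
  also have "\<dots> = (\<Sum>i\<le>degree f. \<Sum>j\<le>degree g. norm (coeff f i) * norm (coeff g j) *
     (\<Sum>m\<le>K. \<Sum>l\<le>K. if l * n + i * s + j = m then 1 else 0))"
    unfolding sum_distrib_left by (intro sum.cong refl) auto
  also have "\<dots> \<le> (\<Sum>i\<le>degree f. \<Sum>j\<le>degree g. norm (coeff f i) * norm (coeff g j) *
     ((real K - real i * real s) / real n + 1))"
    by (intro sum_mono mult_left_mono count) auto
  also have "\<dots> = plen g * (\<Sum>i\<le>degree f. norm (coeff f i) * ((real K - real i * real s) / real n + 1))"
    unfolding plen_def sum_distrib_left sum_distrib_right
    by (simp add: mult_ac)
  finally show ?thesis .
qed

section \<open>Passing from \<open>n\<close> to \<open>n s\<close>\<close>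

text \<open>Substitute x^s for x in the assumption on \<open>\<Psi>\<close> and split the first
  factor by \<open>cyclo_pcompose_prime\<close>.\<close>

lemma cyclo_cofactor_step:
  assumes n: "n > 0" and s: "prime s" "\<not> s dvd n" and \<Psi>: "cyclo n * \<Psi> = 1 - monom 1 n"
  shows "cyclo (n * s) * (cyclo n * (\<Psi> \<circ>\<^sub>p monom 1 s)) = 1 - monom 1 (n * s)"
proof -
  have "cyclo (n * s) * (cyclo n * (\<Psi> \<circ>\<^sub>p monom 1 s)) = (cyclo n * \<Psi>) \<circ>\<^sub>p monom 1 s"
    using cyclo_pcompose_prime[OF n s] by (simp add: pcompose_mult mult.assoc)
  also have "\<dots> = 1 - monom 1 n \<circ>\<^sub>p monom 1 s"
    by (simp add: \<Psi> pcompose_diff pcompose_1)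
  also have "monom 1 n \<circ>\<^sub>p monom 1 s = (monom 1 (n * s) :: complex poly)"
    unfolding pcompose_monom_eq_sum by (simp add: degree_monom_eq if_distrib[of "\<lambda>c. monom c _"] cong: if_cong)
  finally show ?thesis .
qed

lemma cyclo_mult_prime_quotient:
  assumes "n > 0" "prime s" "\<not> s dvd n" "cyclo n * \<Psi> = 1 - monom 1 n"
  shows "cyclo (n * s) * (1 - monom 1 n) = (cyclo n \<circ>\<^sub>p monom 1 s) * \<Psi>"
  using cyclo_pcompose_prime[OF assms(1-3)] assms(4) by (simp add: mult.assoc)

lemma norm_coeff_cyclo_mult_prime_le:
  assumes n: "n > 1" and s: "prime s" "\<not> s dvd n" and \<Psi>: "cyclo n * \<Psi> = 1 - monom 1 n"
    and A: "\<And>i. cmod (coeff (cyclo n) i) \<le> A"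
  shows "cmod (coeff (cyclo (n * s)) m) \<le> A * plen \<Psi>"
proof (rule norm_coeff_quotient_le_plen)
  show "cyclo (n * s) * (1 - monom 1 n) = (cyclo n \<circ>\<^sub>p monom 1 s) * \<Psi>"
    using n s \<Psi> by (intro cyclo_mult_prime_quotient) auto
  show "coprime s n" using s prime_imp_coprime by blast
  show "degree (cyclo n) < n" using n by (simp add: degree_cyclo totient_less)
qed (use n A in auto)

text \<open>The factor 1/2 comes from averaging: \<open>cyclo n\<close> is palindromic in modulus,
  so the count \<open>w i\<close> can be replaced by the mean of \<open>w i\<close> and
  \<open>w (f - i)\<close>, which is at most s/2.\<close>

lemma plen_cyclo_mult_prime_le:
  assumes n: "n > 1" and s: "prime s" "\<not> s dvd n" and \<Psi>: "cyclo n * \<Psi> = 1 - monom 1 n"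
  shows "plen (cyclo (n * s)) \<le> plen (cyclo n) * plen \<Psi> * real s / 2"
proof -
  define f where "f = totient n"
  define K where "K = totient (n * s)"
  have s2: "s \<ge> 2" using s(1) by (rule prime_ge_2_nat)
  have n0: "n > 0" "n * s > 0" using n s2 by auto
  have "coprime n s" using s prime_imp_coprime coprime_commute by blast
  then have "K = f * (s - 1)"
    unfolding K_def f_def using totient_mult_coprime totient_prime[OF s(1)] by simp
  then have K: "real K = real f * (real s - 1)" "f * s = K + f"
    using s2 by (simp_all add: of_nat_diff algebra_simps diff_mult_distrib2)
  have fn: "f \<le> n" by (simp add: f_def totient_le)
  define w where "w i = (real K - real i * real s) / real n + 1" for i
  have "plen (cyclo (n * s)) = (\<Sum>m\<le>K. cmod (coeff (cyclo (n * s)) m))"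
    using n0 by (simp add: plen_def degree_cyclo K_def)
  also have "\<dots> \<le> plen \<Psi> * (\<Sum>i\<le>f. cmod (coeff (cyclo n) i) * w i)"
    unfolding w_def f_def degree_cyclo[OF n0(1), symmetric]
  proof (rule sum_norm_coeff_quotient_le)
    show "cyclo (n * s) * (1 - monom 1 n) = (cyclo n \<circ>\<^sub>p monom 1 s) * \<Psi>"
      using n s \<Psi> by (intro cyclo_mult_prime_quotient) auto
    show "degree (cyclo n) * s \<le> K + n"
      using K(2) fn n0 by (simp add: degree_cyclo flip: f_def)
  qed (use n in auto)
  also have "\<dots> \<le> plen \<Psi> * (plen (cyclo n) * (real s / 2))"
  proof -
    have "(\<Sum>i\<le>f. cmod (coeff (cyclo n) i) * w i) = (\<Sum>i\<le>f. cmod (coeff (cyclo n) (f - i)) * w (f - i))"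
      using sum.nat_diff_reindex[of "\<lambda>i. cmod (coeff (cyclo n) i) * w i" "Suc f"]
      by (simp add: lessThan_Suc_atMost)
    also have "\<dots> = (\<Sum>i\<le>f. cmod (coeff (cyclo n) i) * w (f - i))"
      using norm_coeff_cyclo_reverse[OF n] by (intro sum.cong refl) (simp add: f_def)
    finally have "2 * (\<Sum>i\<le>f. cmod (coeff (cyclo n) i) * w i)
        = (\<Sum>i\<le>f. cmod (coeff (cyclo n) i) * (w i + w (f - i)))"
      by (simp add: sum.distrib distrib_left)
    also have "\<dots> \<le> (\<Sum>i\<le>f. cmod (coeff (cyclo n) i) * real s)"
    proof (intro sum_mono mult_left_mono)
      fix i assume "i \<in> {..f}"
      \<comment> \<open>The terms in i cancel, and 2 K - f s = f (s - 2) remains in the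
        numerator.\<close>
      then have "w i + w (f - i) = real f * (real s - 2) / real n + 2"
        using n by (simp add: w_def K of_nat_diff field_simps)
      also have "real f * (real s - 2) \<le> real n * (real s - 2)"
        using fn s2 by (intro mult_right_mono) auto
      finally show "w i + w (f - i) \<le> real s"
        using n by (simp add: field_simps)
    qed auto
    also have "\<dots> = plen (cyclo n) * real s"
      using n0 by (simp add: plen_def degree_cyclo f_def sum_distrib_right)
    finally show ?thesis by (intro mult_left_mono plen_nonneg) simp
  qed
  finally show ?thesis by (simp add: mult_ac)
qed

section \<open>Explicit polynomials for one and two primes\<close>

lemma one_minus_monom_neq_0:
  assumes "s > 0"
  shows "1 - monom (1::complex) s \<noteq> 0"
proof
  assume "1 - monom (1::complex) s = 0"
  then have "degree (monom (1::complex) s) = degree (1::complex poly)" by simp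
  then show False using assms by (simp add: degree_monom_eq)
qed

lemma geometric_monom_sum:
  "(\<Sum>i<N. monom (1::complex) (i * s)) * (1 - monom 1 s) = 1 - monom 1 (N * s)"
proof (induction N)
  case (Suc N)
  have "(\<Sum>i<Suc N. monom (1::complex) (i * s)) * (1 - monom 1 s) =
      (\<Sum>i<N. monom 1 (i * s)) * (1 - monom 1 s) + monom 1 (N * s) * (1 - monom 1 s)"
    by (simp only: sum.lessThan_Suc distrib_right)
  also have "\<dots> = 1 - monom 1 (N * s) + (monom 1 (N * s) - monom 1 (N * s) * monom 1 s)"
    unfolding Suc.IH by (simp add: right_diff_distrib)
  finally show ?case by (simp add: mult_monom add.commute)
qed simp

lemma cyclo_prime_mult_linear:
  assumes "prime s"
  shows "cyclo s * (1 - monom 1 1) = 1 - monom 1 s"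
proof -
  \<comment> \<open>The cofactor step at n = 1, where \<open>cyclo 1\<close> is x - 1 and its
    cofactor is -1.\<close>
  have "cyclo (1 * s) * (cyclo 1 * ((-1) \<circ>\<^sub>p monom 1 s)) = 1 - monom 1 (1 * s)"
    using assms by (intro cyclo_cofactor_step) (auto simp: cyclo_1[unfolded One_nat_def] monom_Suc monom_0 one_pCons)
  then show ?thesis
    by (simp add: cyclo_1[unfolded One_nat_def] monom_Suc monom_0 pcompose_uminus pcompose_1 one_pCons)
qed

lemma cyclo_prime:
  assumes "prime s"
  shows "cyclo s = (\<Sum>i<s. monom 1 i)"
proof -
  have "cyclo s * (1 - monom 1 1) = (\<Sum>i<s. monom 1 i) * (1 - monom 1 1)"
    using cyclo_prime_mult_linear[OF assms] geometric_monom_sum[where s = 1 and N = s]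
    by (simp only: mult_1_right)
  then show ?thesis using one_minus_monom_neq_0[of 1] by simp
qed

lemma plen_geometric_le: "plen (\<Sum>i<N. monom (1::complex) (h i)) \<le> real N"
  using plen_sum_le[of "\<lambda>i. monom (1::complex) (h i)" "{..<N}"] by simp

lemma plen_cyclo_prime_le: "prime s \<Longrightarrow> plen (cyclo s) \<le> real s"
  using plen_geometric_le[of id s] by (simp add: cyclo_prime)

lemma norm_coeff_cyclo_prime_le: "prime s \<Longrightarrow> cmod (coeff (cyclo s) i) \<le> 1"
  by (simp add: cyclo_prime coeff_sum)

text \<open>Take u as the inverse of p modulo q; then q divides p q + 1 - p u, and v is the
  quotient. Since u > 0, v cannot exceed p.\<close>

lemma obtain_Bezout_nat:
  fixes p q :: nat
  assumes "coprime p q" "p > 1" "q > 1"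
  obtains u v where "u * p + v * q = p * q + 1" "u \<le> q" "v \<le> p"
proof -
  obtain u where u: "[p * u = 1] (mod q)" "u < q"
  proof -
    obtain x where "[p * x = 1] (mod q)"
      using cong_solve_coprime_nat[OF assms(1)] by auto
    then have "[p * (x mod q) = 1] (mod q)" by (simp add: cong_def mod_mult_right_eq)
    then show thesis using that[of "x mod q"] assms(3) by simp
  qed
  have "u > 0" using u assms by (auto simp: cong_def intro: Nat.gr0I)
  have "p * u mod q = 1" using u assms by (simp add: cong_def)
  then have "[p * q + 1 = p * u] (mod q)"
    using assms mod_mult_self3[of p q 1] by (simp add: cong_def)
  moreover have le: "p * u \<le> p * q + 1" using u by (simp add: le_SucI)
  ultimately have "q dvd p * q + 1 - p * u"
    by (simp add: cong_altdef_nat)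
  then obtain v where v: "p * q + 1 - p * u = q * v" by (elim dvdE)
  have eq: "u * p + v * q = p * q + 1" using v le by (simp add: algebra_simps)
  moreover have "v \<le> p"
  proof (rule ccontr)
    assume "\<not> v \<le> p"
    then have "v * q \<ge> (p + 1) * q" by (intro mult_le_mono1) auto
    moreover have "u * p \<ge> p" using \<open>u > 0\<close> by simp
    ultimately show False using eq assms by (simp add: algebra_simps)
  qed
  ultimately show thesis using that u by auto
qed

text \<open>With \<open>u p + v q = p q + 1\<close>, \<open>\<Phi>\<^sub>p\<^sub>q\<close> has \<open>u v\<close> coefficients \<open>1\<close> and
  \<open>(q - u) (p - v)\<close> coefficients \<open>-1\<close>.\<close>

lemma plen_cyclo_two_primes_le:
  assumes p: "prime p" and q: "prime q" and pq: "p \<noteq> q"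
  shows "plen (cyclo (p * q)) \<le> real p * real q / 2"
proof -
  have gt: "p > 1" "q > 1" using p q prime_gt_1_nat by auto
  have "coprime p q" using p q pq primes_coprime by blast
  then obtain u v where uv: "u * p + v * q = p * q + 1" "u \<le> q" "v \<le> p"
    using obtain_Bezout_nat gt by blast
  define G where "G s N = (\<Sum>i<N. monom (1::complex) (i * s))" for s N
  have G: "G s N * (1 - monom 1 s) = 1 - monom 1 (N * s)" for s N
    unfolding G_def by (rule geometric_monom_sum)
  have plen_G': "plen (G s N) * plen (G t M) \<le> real N * real M" for s N t M
    unfolding G_def by (intro mult_mono plen_geometric_le plen_nonneg) auto
  then have plen_G: "plen (G s N * G t M) \<le> real N * real M" for s N t M
    using plen_mult_le order_trans by blast
  let ?xp = "monom (1::complex) p" and ?xq = "monom (1::complex) q" and ?w = "monom (1::complex) (p * q)"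
  let ?a = "monom (1::complex) (u * p)" and ?b = "monom (1::complex) (v * q)" and ?x = "monom (1::complex) 1"
  \<comment> \<open>The target is \<open>cyclo (p * q)\<close> = \<open>G p u * G q v\<close> minus
    x^(-p q) times the product of the two complementary sums. Multiplying by \<open>?w\<close>
    clears the negative exponent.\<close>
  let ?R = "?w * (G p u * G q v) - (?a * G p (q - u)) * (?b * G q (p - v))"
  have ab: "?a * ?b = ?w * ?x" by (simp add: mult_monom uv(1))
  have lhs: "cyclo (p * q) * ((1 - ?xp) * (1 - ?xq)) = (1 - ?w) * (1 - ?x)"
  proof -
    have "cyclo (p * q) * (cyclo p * ((1 - ?x) \<circ>\<^sub>p monom 1 q)) = 1 - ?w"
      using p q pq gt by (intro cyclo_cofactor_step cyclo_prime_mult_linear) (auto simp: prime_nat_iff)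
    moreover have "(1 - ?x) \<circ>\<^sub>p monom 1 q = 1 - ?xq"
      by (simp add: pcompose_diff pcompose_1 monom_Suc monom_0 pcompose_pCons)
    ultimately have "cyclo (p * q) * (cyclo p * (1 - ?xq)) = 1 - ?w" by simp
    then have "cyclo (p * q) * (cyclo p * (1 - ?xq)) * (1 - ?x) = (1 - ?w) * (1 - ?x)"
      by simp
    then show ?thesis
      unfolding cyclo_prime_mult_linear[OF p, symmetric] by (simp only: mult_ac)
  qed
  have "?a * G p (q - u) * (1 - ?xp) = ?a * (1 - monom 1 ((q - u) * p))"
    by (simp only: mult.assoc G)
  also have "\<dots> = ?a - ?w"
  proof -
    have "u * p + (q - u) * p = p * q"
      by (metis add_mult_distrib le_add_diff_inverse mult.commute uv(2))
    then show ?thesis by (simp add: right_diff_distrib mult_monom)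
  qed
  finally have Ga: "?a * G p (q - u) * (1 - ?xp) = ?a - ?w" .
  have "?b * G q (p - v) * (1 - ?xq) = ?b * (1 - monom 1 ((p - v) * q))"
    by (simp only: mult.assoc G)
  also have "\<dots> = ?b - ?w"
  proof -
    have "v * q + (p - v) * q = p * q"
      by (metis add_mult_distrib le_add_diff_inverse uv(3))
    then show ?thesis by (simp add: right_diff_distrib mult_monom)
  qed
  finally have Gb: "?b * G q (p - v) * (1 - ?xq) = ?b - ?w" .
  \<comment> \<open>After multiplication by (1 - x^p)(1 - x^q) all geometric sums collapse to
    binomials, and \<open>ab\<close> yields the factorization.\<close>
  have "?R * ((1 - ?xp) * (1 - ?xq)) = ?w * (G p u * (1 - ?xp)) * (G q v * (1 - ?xq))
      - (?a * G p (q - u) * (1 - ?xp)) * (?b * G q (p - v) * (1 - ?xq))"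
    by algebra
  also have "\<dots> = ?w * (1 - ?a) * (1 - ?b) - (?a - ?w) * (?b - ?w)"
    by (simp only: G Ga Gb)
  also have "\<dots> = ?w * ((1 - ?w) * (1 - ?x))"
    using ab by algebra
  also have "\<dots> = ?w * cyclo (p * q) * ((1 - ?xp) * (1 - ?xq))"
    by (simp only: lhs mult.assoc)
  finally have "?w * cyclo (p * q) = ?R"
    using one_minus_monom_neq_0 gt by simp
  then have "plen (cyclo (p * q)) = plen ?R"
    by (metis plen_monom_mult norm_one mult_1)
  also have "\<dots> \<le> plen (?w * (G p u * G q v)) + plen (- ((?a * G p (q - u)) * (?b * G q (p - v))))"
    using plen_add_le[of "?w * (G p u * G q v)" "- ((?a * G p (q - u)) * (?b * G q (p - v)))"] by simp
  also have "plen (?w * (G p u * G q v)) \<le> real u * real v"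
    using plen_G[of p u q v] by (simp add: plen_monom_mult)
  also have "plen (- ((?a * G p (q - u)) * (?b * G q (p - v)))) \<le> real (q - u) * real (p - v)"
    using plen_mult_le[of "?a * G p (q - u)" "?b * G q (p - v)"] plen_G'[of p "q - u" q "p - v"]
    by (simp add: plen_monom_mult)
  finally have "plen (cyclo (p * q)) \<le> real (u * v + (q - u) * (p - v))" by simp
  moreover have "2 * (u * v + (q - u) * (p - v)) \<le> p * q"
  proof -
    \<comment> \<open>With v q = N + 1 - y, completing the square gives 2 N T = N^2 + 1 - (N + 1 - 2
      y)^2.\<close>
    define N where "N = int p * int q"
    define T where "T = int u * int v + (int q - int u) * (int p - int v)"
    define y where "y = int u * int p"
    have z: "int v * int q = N + 1 - y"
      using uv(1) unfolding N_def y_def by (metis add_diff_cancel_left' of_nat_1 of_nat_add of_nat_mult)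
    have "N > 1" using gt unfolding N_def by (metis less_1_mult of_nat_1 of_nat_less_iff)
    have "N * T = y * (int v * int q) + (N - y) * (N - int v * int q)"
      by (simp add: N_def T_def y_def algebra_simps)
    also have "\<dots> = 2 * y * (N + 1 - y) - N"
      unfolding z by (simp add: algebra_simps)
    finally have "2 * N * T = N\<^sup>2 + 1 - (N + 1 - 2 * y)\<^sup>2"
      by (simp add: power2_eq_square algebra_simps)
    then have "2 * N * T \<le> N\<^sup>2 + 1" by simp
    then have le: "N * (2 * T) \<le> N * N + 1"
      by (simp add: power2_eq_square mult_ac)
    \<comment> \<open>Integrality removes the excess 1: 2 T > N would give N (N + 1) \<le> N^2 + 1,
      which is impossible for N > 1.\<close>
    have "2 * T \<le> N"
    proof (rule ccontr)
      assume "\<not> 2 * T \<le> N"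
      then have "N * (N + 1) \<le> N * (2 * T)" using \<open>N > 1\<close> by (intro mult_left_mono) auto
      then show False using le \<open>N > 1\<close> by (simp add: algebra_simps)
    qed
    then have "int (2 * (u * v + (q - u) * (p - v))) \<le> int (p * q)"
      using uv by (simp add: T_def N_def of_nat_diff)
    then show ?thesis by linarith
  qed
  then have "real (2 * (u * v + (q - u) * (p - v))) \<le> real (p * q)"
    by (simp only: of_nat_le_iff)
  then have "real (u * v + (q - u) * (p - v)) \<le> real p * real q / 2" by simp
  ultimately show ?thesis by linarith
qed

section \<open>Products of odd primes\<close>

lemma cyc_length_eq_plen: "n > 0 \<Longrightarrow> cyc_length n = plen (cyclo n)"
  by (simp add: cyc_length_def plen_def degree_cyclo atMost_atLeast0)

lemma norm_coeff_cyclo_le_height: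
  assumes "n > 0"
  shows "cmod (coeff (cyclo n) i) \<le> cyc_height n"
proof (cases "i \<le> totient n")
  case True
  then show ?thesis unfolding cyc_height_def by (intro Max_ge) auto
next
  case False
  have "cmod (coeff (cyclo n) 0) \<le> cyc_height n"
    unfolding cyc_height_def by (intro Max_ge) auto
  then have "0 \<le> cyc_height n" by (rule order_trans[OF norm_ge_zero])
  then show ?thesis using False assms by (simp add: coeff_eq_0 degree_cyclo)
qed

lemma cyc_height_le: "(\<And>i. cmod (coeff (cyclo n) i) \<le> B) \<Longrightarrow> cyc_height n \<le> B"
  unfolding cyc_height_def by (intro Max.boundedI) auto

lemma cyc_height_ge_1: "n > 0 \<Longrightarrow> cyc_height n \<ge> 1"
  using norm_coeff_cyclo_le_height[of n "totient n"] lead_coeff_cyclo[of n]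
  by (simp add: degree_cyclo)

lemma cyc_height_le_length: "n > 0 \<Longrightarrow> cyc_height n \<le> cyc_length n"
  by (rule cyc_height_le)
     (metis cyc_length_eq_plen coeff_eq_0 finite_atMost atMost_iff leI member_le_sum norm_ge_zero norm_zero plen_def plen_nonneg)

lemma cyc_length_le_height:
  assumes "n > 1"
  shows "cyc_length n \<le> real n * cyc_height n"
proof -
  have "cyc_length n \<le> real (card {0..totient n}) * cyc_height n"
    unfolding cyc_length_def
    using assms by (intro sum_bounded_above norm_coeff_cyclo_le_height) auto
  also have "\<dots> \<le> real n * cyc_height n"
    using assms totient_less[of n] cyc_height_ge_1[of n] by (intro mult_right_mono) auto
  finally show ?thesis .
qed

section \<open>Prime tuples and the monomials of the recursion\<close>

definition tprod :: "(nat \<Rightarrow> nat) \<Rightarrow> nat \<Rightarrow> nat" where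
  "tprod p k = (\<Prod>i\<in>{1..k}. p i)"

text \<open>The monomials of the recursion: \<open>S\<^sub>k\<close> is compared with \<open>tweight p (k - 1) * p k\<close> and
  \<open>Mk (k + 1) p / Mk k p = tweight p (k - 1)\<close>.\<close>

definition tweight :: "(nat \<Rightarrow> nat) \<Rightarrow> nat \<Rightarrow> real" where
  "tweight p k = (\<Prod>i\<in>{1..k}. real (p i) ^ 2 ^ (k - i))"

text \<open>Bounds the length of the cofactor of \<open>cyclo (tprod p k)\<close>: the 2 is the
  length of 1 - x, the cofactor for one prime, and each further prime contributes the length of the
  preceding cyclotomic polynomial.\<close>

definition cofactor_bound :: "(nat \<Rightarrow> nat) \<Rightarrow> nat \<Rightarrow> real" where
  "cofactor_bound p k = 2 * (\<Prod>j\<in>{1..<k}. cyc_length (tprod p j))"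

lemma tprod_Suc: "tprod p (Suc k) = tprod p k * p (Suc k)"
  by (simp add: tprod_def)

lemma tweight_Suc: "tweight p (Suc k) = (tweight p k)\<^sup>2 * real (p (Suc k))"
proof -
  have "(\<Prod>i\<in>{1..k}. real (p i) ^ 2 ^ (Suc k - i)) = (\<Prod>i\<in>{1..k}. (real (p i) ^ 2 ^ (k - i))\<^sup>2)"
    by (intro prod.cong refl) (simp add: Suc_diff_le mult.commute flip: power_mult)
  then show ?thesis
    by (simp add: tweight_def prod_power_distrib)
qed

lemma Mk_Suc: "Mk (Suc (Suc k)) p = Mk (Suc k) p * tweight p k"
proof -
  \<comment> \<open>The range may include i = k, where the exponent 2^0 - 1 is 0; it then matches
    the range of \<open>tweight p k\<close>.\<close>
  have "Mk (Suc k) p = (\<Prod>i\<in>{1..k}. real (p i) ^ (2 ^ (k - i) - 1))"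
    unfolding Mk_def by (rule prod.mono_neutral_cong_left) (auto simp: not_le)
  then have "Mk (Suc k) p * tweight p k =
      (\<Prod>i\<in>{1..k}. real (p i) ^ (2 ^ (k - i) - 1) * real (p i) ^ 2 ^ (k - i))"
    by (simp add: tweight_def prod.distrib)
  also have "\<dots> = (\<Prod>i\<in>{1..k}. real (p i) ^ (2 ^ (Suc k - i) - 1))"
  proof (rule prod.cong)
    fix i assume "i \<in> {1..k}"
    then have "(2::nat) ^ (k - i) - 1 + 2 ^ (k - i) = 2 ^ (Suc k - i) - 1"
      by (simp add: Suc_diff_le)
    then show "real (p i) ^ (2 ^ (k - i) - 1) * real (p i) ^ 2 ^ (k - i) = real (p i) ^ (2 ^ (Suc k - i) - 1)"
      by (metis power_add)
  qed simp
  finally show ?thesis by (simp add: Mk_def)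
qed

lemma odd_prime_tuple_mono: "odd_prime_tuple k p \<Longrightarrow> j \<le> k \<Longrightarrow> odd_prime_tuple j p"
  by (simp add: odd_prime_tuple_def)

lemma odd_prime_tuple_prime: "odd_prime_tuple k p \<Longrightarrow> 1 \<le> i \<Longrightarrow> i \<le> k \<Longrightarrow> prime (p i)"
  by (simp add: odd_prime_tuple_def)

lemma odd_prime_tuple_less: "odd_prime_tuple k p \<Longrightarrow> 1 \<le> i \<Longrightarrow> i < j \<Longrightarrow> j \<le> k \<Longrightarrow> p i < p j"
  by (simp add: odd_prime_tuple_def)

lemma tprod_pos: "odd_prime_tuple k p \<Longrightarrow> tprod p k > 0"
  unfolding tprod_def odd_prime_tuple_def by (intro prod_pos) (auto dest: prime_gt_0_nat)

lemma tprod_gt_1: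
  assumes "odd_prime_tuple (Suc k) p"
  shows "tprod p (Suc k) > 1"
  using tprod_pos[OF odd_prime_tuple_mono[OF assms, of k]]
    prime_gt_1_nat[OF odd_prime_tuple_prime[OF assms, of "Suc k"]]
  by (simp add: tprod_Suc less_1_mult' one_less_mult Suc_lessI)

lemma tweight_pos: "odd_prime_tuple k p \<Longrightarrow> tweight p k > 0"
  unfolding tweight_def odd_prime_tuple_def by (intro prod_pos) (auto dest: prime_gt_0_nat)

lemma Mk_pos: "odd_prime_tuple k p \<Longrightarrow> Mk k p > 0"
  unfolding Mk_def odd_prime_tuple_def by (intro prod_pos) (auto dest: prime_gt_0_nat)

lemma not_dvd_tprod:
  assumes "odd_prime_tuple (Suc k) p"
  shows "\<not> p (Suc k) dvd tprod p k"
proof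
  assume "p (Suc k) dvd tprod p k"
  then obtain i where i: "i \<in> {1..k}" "p (Suc k) dvd p i"
    unfolding tprod_def using odd_prime_tuple_prime[OF assms, of "Suc k"]
    by (auto simp: prime_dvd_prod_iff)
  then have "p (Suc k) = p i"
    using odd_prime_tuple_prime[OF assms] by (intro primes_dvd_imp_eq) auto
  then show False using odd_prime_tuple_less[OF assms, of i "Suc k"] i by auto
qed

lemma cofactor_bound_nonneg: "odd_prime_tuple k p \<Longrightarrow> cofactor_bound p k \<ge> 0"
  unfolding cofactor_bound_def cyc_length_def
  by (intro mult_nonneg_nonneg prod_nonneg ballI sum_nonneg) auto

lemma cofactor_bound_Suc:
  "cofactor_bound p (Suc (Suc k)) = cofactor_bound p (Suc k) * cyc_length (tprod p (Suc k))"
  by (simp add: cofactor_bound_def prod.atLeastLessThan_Suc)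

text \<open>Induction along \<open>cyclo_cofactor_step\<close>: length is submultiplicative, and
  substituting x^s does not increase it.\<close>

lemma cyclo_cofactor_exists:
  assumes "odd_prime_tuple (Suc k) p"
  shows "\<exists>\<Psi>. cyclo (tprod p (Suc k)) * \<Psi> = 1 - monom 1 (tprod p (Suc k)) \<and>
    plen \<Psi> \<le> cofactor_bound p (Suc k)"
  using assms
proof (induction k)
  case 0
  have "plen (1 - monom 1 1 :: complex poly) \<le> plen (1 :: complex poly) + plen (- monom 1 1 :: complex poly)"
    using plen_add_le[of 1 "- monom 1 1 :: complex poly"] by simp
  then have "plen (1 - monom 1 1 :: complex poly) \<le> 2"
    using plen_monom[of "1 :: complex" 0] by (simp add: monom_0 one_pCons)
  then show ?case
    using cyclo_prime_mult_linear[OF odd_prime_tuple_prime[OF 0, of 1]]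
    by (intro exI[of _ "1 - monom 1 1"]) (simp add: tprod_def cofactor_bound_def)
next
  case (Suc k)
  let ?n = "tprod p (Suc k)" and ?s = "p (Suc (Suc k))"
  have tup: "odd_prime_tuple (Suc k) p"
    using Suc.prems by (rule odd_prime_tuple_mono) simp
  obtain \<Psi> where \<Psi>: "cyclo ?n * \<Psi> = 1 - monom 1 ?n" "plen \<Psi> \<le> cofactor_bound p (Suc k)"
    using Suc.IH[OF tup] by blast
  have "cyclo (?n * ?s) * (cyclo ?n * (\<Psi> \<circ>\<^sub>p monom 1 ?s)) = 1 - monom 1 (?n * ?s)"
    using tprod_pos[OF tup] odd_prime_tuple_prime[OF Suc.prems, of "Suc (Suc k)"]
      not_dvd_tprod[OF Suc.prems] \<Psi>(1) by (intro cyclo_cofactor_step) auto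
  moreover have "plen (cyclo ?n * (\<Psi> \<circ>\<^sub>p monom 1 ?s)) \<le> cofactor_bound p (Suc (Suc k))"
  proof -
    have "plen (cyclo ?n * (\<Psi> \<circ>\<^sub>p monom 1 ?s)) \<le> plen (cyclo ?n) * plen (\<Psi> \<circ>\<^sub>p monom 1 ?s)"
      by (rule plen_mult_le)
    also have "\<dots> \<le> plen (cyclo ?n) * cofactor_bound p (Suc k)"
      using plen_pcompose_monom_le \<Psi>(2) by (intro mult_left_mono plen_nonneg) (rule order_trans)
    finally show ?thesis
      using tprod_pos[OF tup] by (simp add: cofactor_bound_Suc cyc_length_eq_plen mult.commute)
  qed
  ultimately show ?case by (metis tprod_Suc)
qed

lemma cyc_height_tprod_Suc_le:
  assumes tup: "odd_prime_tuple (Suc (Suc k)) p"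
  shows "cyc_height (tprod p (Suc (Suc k))) \<le> cyc_height (tprod p (Suc k)) * cofactor_bound p (Suc k)"
proof -
  have tup': "odd_prime_tuple (Suc k) p"
    using tup by (rule odd_prime_tuple_mono) simp
  obtain \<Psi> where \<Psi>: "cyclo (tprod p (Suc k)) * \<Psi> = 1 - monom 1 (tprod p (Suc k))"
      "plen \<Psi> \<le> cofactor_bound p (Suc k)"
    using cyclo_cofactor_exists[OF tup'] by blast
  have "cyc_height (tprod p (Suc (Suc k))) \<le> cyc_height (tprod p (Suc k)) * plen \<Psi>"
    unfolding tprod_Suc[of p "Suc k"]
    using tprod_gt_1[OF tup'] odd_prime_tuple_prime[OF tup, of "Suc (Suc k)"] not_dvd_tprod[OF tup] \<Psi>(1)
    by (intro cyc_height_le norm_coeff_cyclo_mult_prime_le norm_coeff_cyclo_le_height) auto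
  also have "\<dots> \<le> cyc_height (tprod p (Suc k)) * cofactor_bound p (Suc k)"
    using cyc_height_ge_1[OF tprod_pos[OF tup']] \<Psi>(2) by (intro mult_left_mono) auto
  finally show ?thesis .
qed

lemma cyc_length_tprod_Suc_le:
  assumes tup: "odd_prime_tuple (Suc (Suc k)) p"
  shows "cyc_length (tprod p (Suc (Suc k))) \<le>
    cyc_length (tprod p (Suc k)) * cofactor_bound p (Suc k) * real (p (Suc (Suc k))) / 2"
proof -
  have tup': "odd_prime_tuple (Suc k) p"
    using tup by (rule odd_prime_tuple_mono) simp
  let ?n = "tprod p (Suc k)" and ?s = "p (Suc (Suc k))"
  obtain \<Psi> where \<Psi>: "cyclo ?n * \<Psi> = 1 - monom 1 ?n" "plen \<Psi> \<le> cofactor_bound p (Suc k)"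
    using cyclo_cofactor_exists[OF tup'] by blast
  have "cyc_length (tprod p (Suc (Suc k))) = plen (cyclo (?n * ?s))"
    using tprod_pos[OF tup] by (simp add: cyc_length_eq_plen tprod_Suc[of p "Suc k"])
  also have "\<dots> \<le> plen (cyclo ?n) * plen \<Psi> * real ?s / 2"
    using tprod_gt_1[OF tup'] odd_prime_tuple_prime[OF tup, of "Suc (Suc k)"] not_dvd_tprod[OF tup] \<Psi>(1)
    by (intro plen_cyclo_mult_prime_le) auto
  also have "\<dots> \<le> plen (cyclo ?n) * cofactor_bound p (Suc k) * real ?s / 2"
    using \<Psi>(2) by (intro divide_right_mono mult_right_mono mult_left_mono plen_nonneg) auto
  finally show ?thesis using tprod_pos[OF tup'] by (simp add: cyc_length_eq_plen)
qed

section \<open>Bounds for up to three primes\<close>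

context
  fixes p :: "nat \<Rightarrow> nat"
  assumes tup: "odd_prime_tuple 3 p"
begin

lemma cyc_length_1_le: "cyc_length (tprod p 1) \<le> real (p 1)"
  using odd_prime_tuple_prime[OF tup, of 1] prime_gt_0_nat[of "p 1"]
  by (simp add: tprod_def cyc_length_eq_plen plen_cyclo_prime_le)

lemma cyc_length_2_le: "cyc_length (tprod p 2) \<le> real (p 1) * real (p 2) / 2"
proof -
  have "tprod p 2 = p 1 * p 2" by (simp add: tprod_def numeral_2_eq_2)
  moreover have "tprod p 2 > 0" by (rule tprod_pos[OF odd_prime_tuple_mono[OF tup]]) simp
  ultimately show ?thesis
    using odd_prime_tuple_prime[OF tup, of 1] odd_prime_tuple_prime[OF tup, of 2]
      odd_prime_tuple_less[OF tup, of 1 2] plen_cyclo_two_primes_le[of "p 1" "p 2"]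
    by (simp add: cyc_length_eq_plen)
qed

lemma cofactor_bound_2_le: "cofactor_bound p 2 \<le> 2 * real (p 1)"
  using cyc_length_1_le by (simp add: cofactor_bound_def numeral_2_eq_2)

text \<open>The 1/2 in \<open>cyc_length_2_le\<close> cancels the initial 2 of
  \<open>cofactor_bound\<close>, leaving p_1^2 p_2 with constant 1.\<close>

lemma cofactor_bound_3_le: "cofactor_bound p 3 \<le> tweight p 2"
proof -
  have "cofactor_bound p 3 = 2 * (cyc_length (tprod p 1) * cyc_length (tprod p 2))"
    by (simp add: cofactor_bound_def eval_nat_numeral)
  also have "cyc_length (tprod p 1) * cyc_length (tprod p 2) \<le> real (p 1) * (real (p 1) * real (p 2) / 2)"
    by (intro mult_mono cyc_length_1_le cyc_length_2_le) (auto simp: cyc_length_def intro: sum_nonneg)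
  finally show ?thesis by (simp add: tweight_def eval_nat_numeral)
qed

text \<open>Serves to show that the supremum \<open>dconst\<close> is over a bounded set.\<close>

lemma cyc_length_3_le: "cyc_length (tprod p 3) \<le> real (p 1) ^ 2 * real (p 2) * real (p 3)"
proof -
  have "cyc_length (tprod p 3) \<le> cyc_length (tprod p 2) * cofactor_bound p 2 * real (p 3) / 2"
    using cyc_length_tprod_Suc_le[of 1 p] tup by (simp add: eval_nat_numeral)
  also have "\<dots> \<le> (real (p 1) * real (p 2) / 2) * (2 * real (p 1)) * real (p 3) / 2"
    using odd_prime_tuple_mono[OF tup, of 2]
    by (intro divide_right_mono mult_right_mono mult_mono cyc_length_2_le cofactor_bound_2_le
        cofactor_bound_nonneg) auto
  also have "\<dots> \<le> real (p 1) ^ 2 * real (p 2) * real (p 3)"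
    by (simp add: power2_eq_square)
  finally show ?thesis .
qed

text \<open>Heights are at most 1 and 2 for one and two primes, and the third prime costs a factor
  of at most 2 p_1. This makes the set behind \<open>eps 3\<close> bounded.\<close>

lemma cyc_height_3_le: "cyc_height (tprod p 3) \<le> 4 * real (p 1)"
proof -
  have t2: "odd_prime_tuple 2 p" using tup by (rule odd_prime_tuple_mono) simp
  have "cyc_height (tprod p 1) \<le> 1"
    using odd_prime_tuple_prime[OF tup, of 1]
    by (intro cyc_height_le) (simp add: tprod_def norm_coeff_cyclo_prime_le)
  then have "cyc_height (tprod p 2) \<le> 2"
    using cyc_height_tprod_Suc_le[of 0 p] t2 by (simp add: cofactor_bound_def eval_nat_numeral)
  then have "cyc_height (tprod p 2) * cofactor_bound p 2 \<le> 2 * (2 * real (p 1))"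
    by (intro mult_mono cofactor_bound_2_le cofactor_bound_nonneg t2) auto
  then show ?thesis
    using cyc_height_tprod_Suc_le[of 1 p] tup by (simp add: eval_nat_numeral)
qed

end

section \<open>Bounds on the constants\<close>

lemma odd_prime_tuple_exists: "\<exists>p. odd_prime_tuple k p"
proof -
  define S :: "nat set" where "S = {q. prime q} - {2}"
  have inf: "infinite S" unfolding S_def using primes_infinite by simp
  have "prime (enumerate S i) \<and> odd (enumerate S i)" for i
  proof -
    have "prime (enumerate S i)" "enumerate S i \<noteq> 2"
      using enumerate_in_set[OF inf, of i] by (auto simp: S_def)
    then show ?thesis using prime_odd_nat[of "enumerate S i"] prime_ge_2_nat[of "enumerate S i"] by simp
  qed
  then have "odd_prime_tuple k (enumerate S)"
    by (simp add: odd_prime_tuple_def enumerate_mono[OF _ inf])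
  then show ?thesis by blast
qed

lemma bdd_above_height_ratio_3:
  "bdd_above {cyc_height (\<Prod>i\<in>{1..3}. p i) / Mk 3 p | p. odd_prime_tuple 3 p}"
proof (rule bdd_aboveI)
  fix x assume "x \<in> {cyc_height (\<Prod>i\<in>{1..3}. p i) / Mk 3 p | p. odd_prime_tuple 3 p}"
  then obtain p where p: "odd_prime_tuple 3 p" and x: "x = cyc_height (tprod p 3) / Mk 3 p"
    by (auto simp: tprod_def)
  have "Mk 3 p = real (p 1)" by (simp add: Mk_def)
  then show "x \<le> 4"
    using cyc_height_3_le[OF p] Mk_pos[OF p] by (simp add: x divide_le_eq)
qed

lemma cyc_height_3_le_eps:
  assumes "odd_prime_tuple 3 p"
  shows "cyc_height (tprod p 3) \<le> eps 3 * real (p 1)"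
proof -
  have "cyc_height (tprod p 3) / Mk 3 p \<le> eps 3"
    unfolding eps_def tprod_def by (rule cSup_upper[OF _ bdd_above_height_ratio_3]) (use assms in blast)
  moreover have "Mk 3 p = real (p 1)" by (simp add: Mk_def)
  ultimately show ?thesis using Mk_pos[OF assms] by (simp add: divide_le_eq)
qed

text \<open>Links the three separate primes in \<open>dconst\<close> to
  \<open>odd_prime_tuple\<close>; every index other than 1 and 2 is sent to r.\<close>

definition triple :: "nat \<Rightarrow> nat \<Rightarrow> nat \<Rightarrow> nat \<Rightarrow> nat" where
  "triple p q r i = (if i = 1 then p else if i = 2 then q else r)"

lemma odd_prime_tuple_triple:
  assumes "prime p" "prime q" "prime r" "odd p" "p < q" "q < r"
  shows "odd_prime_tuple 3 (triple p q r)"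
proof -
  have "p > 2" using assms(1,4) prime_ge_2_nat[of p] by (cases "p = 2") auto
  then have "odd q" "odd r" using assms prime_odd_nat by (meson less_trans)+
  moreover have "{1..3::nat} = {1, 2, 3}" by auto
  ultimately show ?thesis using assms by (simp add: odd_prime_tuple_def triple_def)
qed

lemma tprod_triple: "tprod (triple p q r) 3 = p * q * r"
  by (simp add: tprod_def triple_def numeral_3_eq_3)

text \<open>The primes 3, 5, 7 suffice: the height for 105 is at least the leading coefficient 1,
  and \<open>Mk\<close> is 3.\<close>

lemma eps_3_ge: "eps 3 \<ge> 1 / 3"
proof -
  have pr: "prime (3::nat)" "prime (5::nat)" "prime (7::nat)" by simp_all
  have "odd_prime_tuple 3 (triple 3 5 7)"
    using pr by (intro odd_prime_tuple_triple) auto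
  then have "cyc_height 105 \<le> eps 3 * 3"
    using cyc_height_3_le_eps[of "triple 3 5 7"] by (simp add: tprod_triple) (simp add: triple_def)
  then show ?thesis using cyc_height_ge_1[of 105] by simp
qed

lemma bdd_above_length_ratio:
  "bdd_above {cyc_length (p*q*r) / (real p ^ 2 * real q * real r) | p q r.
      prime p \<and> prime q \<and> prime r \<and> odd p \<and> p < q \<and> q < r}"
proof (rule bdd_aboveI)
  fix x assume "x \<in> {cyc_length (p*q*r) / (real p ^ 2 * real q * real r) | p q r.
      prime p \<and> prime q \<and> prime r \<and> odd p \<and> p < q \<and> q < r}"
  then obtain p q r where pqr: "prime p" "prime q" "prime r" "odd p" "p < q" "q < r"
    and x: "x = cyc_length (p*q*r) / (real p ^ 2 * real q * real r)" by blast
  have "cyc_length (p * q * r) \<le> real p ^ 2 * real q * real r"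
    using cyc_length_3_le[OF odd_prime_tuple_triple[OF pqr]] by (simp add: tprod_triple triple_def)
  moreover have "real p ^ 2 * real q * real r > 0"
    using pqr by (simp add: prime_gt_0_nat)
  ultimately show "x \<le> 1" by (simp add: x divide_le_eq)
qed

lemma cyc_length_3_le_dconst:
  assumes "odd_prime_tuple 3 p"
  shows "cyc_length (tprod p 3) \<le> dconst * (tweight p 2 * real (p 3))"
proof -
  have pr: "prime (p 1)" "prime (p 2)" "prime (p 3)" "odd (p 1)" "p 1 < p 2" "p 2 < p 3"
    using assms by (simp_all add: odd_prime_tuple_def)
  have "{1..3} = {1, 2, 3 :: nat}" "{1..2} = {1, 2 :: nat}" by auto
  then have t: "tprod p 3 = p 1 * p 2 * p 3"
    and w: "tweight p 2 * real (p 3) = real (p 1) ^ 2 * real (p 2) * real (p 3)"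
    by (simp_all add: tprod_def tweight_def)
  have "cyc_length (p 1 * p 2 * p 3) / (real (p 1) ^ 2 * real (p 2) * real (p 3)) \<le> dconst"
    unfolding dconst_def by (rule cSup_upper[OF _ bdd_above_length_ratio]) (use pr in blast)
  moreover have "real (p 1) ^ 2 * real (p 2) * real (p 3) > 0"
    using pr by (simp add: prime_gt_0_nat)
  ultimately show ?thesis unfolding t w by (simp add: divide_le_eq)
qed

lemma dconst_pos: "dconst > 0"
proof -
  obtain p where p: "odd_prime_tuple 3 p" using odd_prime_tuple_exists by blast
  have "1 \<le> cyc_length (tprod p 3)"
    using cyc_height_ge_1[OF tprod_pos[OF p]] cyc_height_le_length[OF tprod_pos[OF p]] by linarith
  then have "0 < dconst * (tweight p 2 * real (p 3))"
    using cyc_length_3_le_dconst[OF p] by linarith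
  moreover have "0 < tweight p 2 * real (p 3)"
    using tweight_pos[OF odd_prime_tuple_mono[OF p, of 2]] prime_gt_0_nat[OF odd_prime_tuple_prime[OF p, of 3]]
    by simp
  ultimately show ?thesis by (simp add: zero_less_mult_iff)
qed

text \<open>At most p q r coefficients, each of modulus at most \<open>eps 3\<close> times p, give
  length at most \<open>eps 3\<close> times p^2 q r.\<close>

lemma dconst_le_eps_3: "dconst \<le> eps 3"
  unfolding dconst_def
proof (rule cSup_least)
  have "prime (3::nat)" "prime (5::nat)" "prime (7::nat)" "odd (3::nat)" "3 < (5::nat)" "5 < (7::nat)"
    by simp_all
  then show "{cyc_length (p*q*r) / (real p ^ 2 * real q * real r) | p q r.
      prime p \<and> prime q \<and> prime r \<and> odd p \<and> p < q \<and> q < r} \<noteq> {}" by blast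
next
  fix x assume "x \<in> {cyc_length (p*q*r) / (real p ^ 2 * real q * real r) | p q r.
      prime p \<and> prime q \<and> prime r \<and> odd p \<and> p < q \<and> q < r}"
  then obtain p q r where pqr: "prime p" "prime q" "prime r" "odd p" "p < q" "q < r"
    and x: "x = cyc_length (p*q*r) / (real p ^ 2 * real q * real r)" by blast
  note tup = odd_prime_tuple_triple[OF pqr]
  have "p * q * r > 1" using tprod_gt_1[of 2 "triple p q r"] tup by (simp flip: tprod_triple)
  then have "cyc_length (p * q * r) \<le> real (p * q * r) * cyc_height (p * q * r)"
    by (rule cyc_length_le_height)
  also have "\<dots> \<le> real (p * q * r) * (eps 3 * real p)"
    using cyc_height_3_le_eps[OF tup]
    by (intro mult_left_mono) (auto simp: tprod_triple, simp add: triple_def)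
  also have "\<dots> = eps 3 * (real p ^ 2 * real q * real r)"
    by (simp add: power2_eq_square)
  finally show "x \<le> eps 3"
    using pqr by (simp add: x divide_le_eq prime_gt_0_nat)
qed

section \<open>The recursion for lengths and heights\<close>

text \<open>The two bounds are proved together: the product of length and cofactor bound is the next
  cofactor bound and, times half the next prime, bounds the next length. Each step squares the power
  of \<open>dconst / 2\<close>.\<close>

lemma cyc_length_and_cofactor_bound_le:
  assumes "odd_prime_tuple (m + 4) p"
  shows "cyc_length (tprod p (m + 4)) \<le> (dconst / 2) ^ 2 ^ m * (tweight p (m + 3) * real (p (m + 4))) \<and>
    cofactor_bound p (m + 4) \<le> 2 * (dconst / 2) ^ 2 ^ m * tweight p (m + 3)"
  using assms
proof (induction m)
  case 0
  have t4: "odd_prime_tuple 4 p" using 0 by simp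
  have t3: "odd_prime_tuple 3 p" using t4 by (rule odd_prime_tuple_mono) simp
  have w2: "tweight p 2 > 0" using odd_prime_tuple_mono[OF t3, of 2] tweight_pos by simp
  have w3: "tweight p 3 = tweight p 2 * (tweight p 2 * real (p 3))"
    using tweight_Suc[of p 2] by (simp add: power2_eq_square)
  have prod: "cyc_length (tprod p 3) * cofactor_bound p 3 \<le> dconst * tweight p 3"
  proof -
    have "cyc_length (tprod p 3) * cofactor_bound p 3 \<le> dconst * (tweight p 2 * real (p 3)) * tweight p 2"
      using dconst_pos w2
      by (intro mult_mono cyc_length_3_le_dconst cofactor_bound_3_le cofactor_bound_nonneg t3) auto
    then show ?thesis by (simp add: w3 mult_ac)
  qed
  have "cyc_length (tprod p 4) \<le> cyc_length (tprod p 3) * cofactor_bound p 3 * real (p 4) / 2"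
    using cyc_length_tprod_Suc_le[of 2 p] t4 by simp
  also have "\<dots> \<le> dconst * tweight p 3 * real (p 4) / 2"
    by (intro divide_right_mono mult_right_mono prod) auto
  finally have "cyc_length (tprod p 4) \<le> dconst / 2 * (tweight p 3 * real (p 4))" by simp
  moreover have "cofactor_bound p 4 \<le> dconst * tweight p 3"
    using cofactor_bound_Suc[of p 2] prod by (simp add: mult.commute)
  ultimately show ?case by simp
next
  case (Suc m)
  have S: "Suc (m + 3) = m + 4" "Suc (m + 4) = m + 5" "Suc m + 4 = m + 5" "Suc m + 3 = m + 4"
    by simp_all
  let ?e = "(dconst / 2) ^ 2 ^ m" and ?w = "tweight p (m + 3)" and ?s = "real (p (m + 4))"
  have t: "odd_prime_tuple (m + 4) p" using Suc.prems by (rule odd_prime_tuple_mono) simp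
  have len: "cyc_length (tprod p (m + 4)) \<le> ?e * (?w * ?s)"
    and cof: "cofactor_bound p (m + 4) \<le> 2 * ?e * ?w"
    using Suc.IH[OF t] by auto
  have w: "tweight p (m + 4) = ?w * (?w * ?s)"
    using tweight_Suc[of p "m + 3"] unfolding S by (simp add: power2_eq_square mult.assoc)
  have w0: "?w > 0" using odd_prime_tuple_mono[OF t, of "m + 3"] tweight_pos by simp
  have prod: "cyc_length (tprod p (m + 4)) * cofactor_bound p (m + 4) \<le>
      2 * (dconst / 2) ^ 2 ^ Suc m * tweight p (m + 4)"
  proof -
    have "cyc_length (tprod p (m + 4)) * cofactor_bound p (m + 4) \<le> (?e * (?w * ?s)) * (2 * ?e * ?w)"
      using dconst_pos w0 by (intro mult_mono len cof cofactor_bound_nonneg t) auto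
    also have "\<dots> = 2 * (?e * ?e) * tweight p (m + 4)" by (simp add: w)
    also have "?e * ?e = (dconst / 2) ^ 2 ^ Suc m" by (simp flip: power_add add: mult_2)
    finally show ?thesis .
  qed
  have "cyc_length (tprod p (Suc m + 4)) \<le>
      cyc_length (tprod p (m + 4)) * cofactor_bound p (m + 4) * real (p (Suc m + 4)) / 2"
    using cyc_length_tprod_Suc_le[of "m + 3" p] Suc.prems unfolding S by blast
  also have "\<dots> \<le> 2 * (dconst / 2) ^ 2 ^ Suc m * tweight p (m + 4) * real (p (Suc m + 4)) / 2"
    by (intro divide_right_mono mult_right_mono prod) auto
  finally have "cyc_length (tprod p (Suc m + 4)) \<le>
      (dconst / 2) ^ 2 ^ Suc m * (tweight p (Suc m + 3) * real (p (Suc m + 4)))"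
    unfolding S by (simp add: mult.assoc)
  moreover have "cofactor_bound p (Suc m + 4) \<le> 2 * (dconst / 2) ^ 2 ^ Suc m * tweight p (Suc m + 3)"
    using cofactor_bound_Suc[of p "m + 3"] prod unfolding S by (simp add: mult.commute)
  ultimately show ?case by blast
qed

text \<open>Passing from three to four primes costs only \<open>tweight p 2\<close>. Each later step
  costs \<open>2 * (dconst / 2) ^ 2 ^ m\<close> and a weight absorbed by \<open>Mk_Suc\<close>; the
  exponents add up as 1 + 2 + ... + 2^(m-1) = 2^m - 1.\<close>

lemma cyc_height_tprod_le:
  assumes "odd_prime_tuple (m + 4) p"
  shows "cyc_height (tprod p (m + 4)) \<le> eps 3 * 2 ^ m * (dconst / 2) ^ (2 ^ m - 1) * Mk (m + 4) p"
  using assms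
proof (induction m)
  case 0
  have t4: "odd_prime_tuple 4 p" using 0 by simp
  have t3: "odd_prime_tuple 3 p" using t4 by (rule odd_prime_tuple_mono) simp
  have M: "Mk 4 p = real (p 1) * tweight p 2"
    using Mk_Suc[of 2 p] by (simp add: Mk_def)
  have "cyc_height (tprod p 4) \<le> cyc_height (tprod p 3) * cofactor_bound p 3"
    using cyc_height_tprod_Suc_le[of 2 p] t4 by simp
  also have "\<dots> \<le> (eps 3 * real (p 1)) * tweight p 2"
    using eps_3_ge
    by (intro mult_mono cyc_height_3_le_eps cofactor_bound_3_le cofactor_bound_nonneg t3) auto
  finally show ?case by (simp add: M)
next
  case (Suc m)
  have S: "Suc (m + 3) = m + 4" "Suc (m + 4) = m + 5" "Suc m + 4 = m + 5" "Suc m + 3 = m + 4"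
    by simp_all
  let ?e = "(dconst / 2) ^ 2 ^ m" and ?w = "tweight p (m + 3)"
  have t: "odd_prime_tuple (m + 4) p" using Suc.prems by (rule odd_prime_tuple_mono) simp
  have cof: "cofactor_bound p (m + 4) \<le> 2 * ?e * ?w"
    using cyc_length_and_cofactor_bound_le[OF t] by blast
  have M: "Mk (Suc m + 4) p = Mk (m + 4) p * ?w"
    using Mk_Suc[of "m + 3" p] unfolding S .
  have e: "(dconst / 2) ^ (2 ^ m - 1) * ?e = (dconst / 2) ^ (2 ^ Suc m - 1)"
    by (simp flip: power_add add: mult_2)
  have "cyc_height (tprod p (Suc m + 4)) \<le> cyc_height (tprod p (m + 4)) * cofactor_bound p (m + 4)"
    using cyc_height_tprod_Suc_le[of "m + 3" p] Suc.prems unfolding S by blast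
  also have "\<dots> \<le> (eps 3 * 2 ^ m * (dconst / 2) ^ (2 ^ m - 1) * Mk (m + 4) p) * (2 * ?e * ?w)"
    using eps_3_ge dconst_pos Mk_pos[OF t] by (intro mult_mono Suc.IH cof cofactor_bound_nonneg t) auto
  also have "\<dots> = eps 3 * 2 ^ Suc m * ((dconst / 2) ^ (2 ^ m - 1) * ?e) * (Mk (m + 4) p * ?w)"
    by simp
  finally show ?case unfolding M e .
qed

text \<open>Positivity permits taking logarithms later. It rests on the upper bound, which makes the
  supremum a genuine one.\<close>

lemma eps_bounds:
  shows "eps (m + 4) > 0"
    and "eps (m + 4) \<le> eps 3 * 2 ^ m * (dconst / 2) ^ (2 ^ m - 1)"
proof -
  let ?B = "eps 3 * 2 ^ m * (dconst / 2) ^ (2 ^ m - 1)"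
  let ?X = "{cyc_height (\<Prod>i\<in>{1..m + 4}. p i) / Mk (m + 4) p | p. odd_prime_tuple (m + 4) p}"
  have le: "x \<le> ?B" if "x \<in> ?X" for x
  proof -
    from that obtain p where p: "odd_prime_tuple (m + 4) p" and x: "x = cyc_height (tprod p (m + 4)) / Mk (m + 4) p"
      by (auto simp: tprod_def)
    show ?thesis using cyc_height_tprod_le[OF p] Mk_pos[OF p] by (simp add: x divide_le_eq)
  qed
  obtain p where p: "odd_prime_tuple (m + 4) p" using odd_prime_tuple_exists by blast
  then have mem: "cyc_height (tprod p (m + 4)) / Mk (m + 4) p \<in> ?X"
    by (auto simp: tprod_def)
  have eps_eq: "eps (m + 4) = Sup ?X" by (rule eps_def)
  show "eps (m + 4) \<le> ?B"
    unfolding eps_eq by (rule cSup_least[OF _ le]) (use mem in blast)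
  have "0 < cyc_height (tprod p (m + 4)) / Mk (m + 4) p"
    using cyc_height_ge_1[OF tprod_pos[OF p]] Mk_pos[OF p] by simp
  also have "\<dots> \<le> eps (m + 4)"
    unfolding eps_eq by (rule cSup_upper[OF mem]) (rule bdd_aboveI[OF le])
  finally show "eps (m + 4) > 0" .
qed

section \<open>Numerical comparison with \<open>Cconst\<close>\<close>

text \<open>Every base is at least 5/6 and the exponents 1/2^i sum to 2, so the product is at least
  (5/6)^2.\<close>

lemma rho_ge: "rho \<ge> 25 / 36"
proof -
  define f :: "nat \<Rightarrow> real" where "f i = ln ((2 * real i + 5) / (2 * real i + 6)) / 2 ^ i" for i
  define g :: "nat \<Rightarrow> real" where "g i = ln (5 / 6) * (1 / 2) ^ i" for i
  have g: "g sums (ln (5 / 6) * 2)"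
    unfolding g_def using geometric_sums[of "1 / 2 :: real"] by (intro sums_mult) simp
  have gf: "g i \<le> f i" for i
  proof -
    have "(5 / 6 :: real) \<le> (2 * real i + 5) / (2 * real i + 6)" by (simp add: field_simps)
    then have "ln (5 / 6 :: real) \<le> ln ((2 * real i + 5) / (2 * real i + 6))" by (subst ln_le_cancel_iff) auto
    then show ?thesis by (simp add: f_def g_def power_one_over divide_right_mono)
  qed
  have f0: "f i \<le> 0" for i
  proof -
    have "ln ((2 * real i + 5) / (2 * real i + 6)) \<le> 0" by (subst ln_le_zero_iff) auto
    then show ?thesis by (simp add: f_def divide_nonpos_nonneg)
  qed
  \<comment> \<open>Each \<open>f i\<close> lies between \<open>g i\<close> and 0, so the geometric
    series forces convergence; only then does \<open>prodinf_exp\<close> evaluate the infinite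
    product.\<close>
  have "summable (\<lambda>i. - f i)"
    by (rule summable_comparison_test'[where g = "\<lambda>i. - g i" and N = 0])
       (use gf f0 g in \<open>auto simp: sums_iff intro: summable_minus\<close>)
  then have f: "summable f" by (simp add: summable_minus_iff)
  have "ln (5 / 6) * 2 \<le> suminf f"
    using suminf_le[OF gf _ f] g by (simp add: sums_iff)
  moreover have "rho = exp (suminf f)"
  proof -
    have "((2 * real i + 5) / (2 * real i + 6)) powr (1 / 2 ^ i) = exp (f i)" for i
      by (simp add: powr_def f_def)
    then show ?thesis unfolding rho_def using prodinf_exp[OF f] by simp
  qed
  moreover have "exp (ln (5 / 6) * 2) = (25 / 36 :: real)"
    using exp_double[of "ln (5 / 6 :: real)"] by (simp add: mult.commute power2_eq_square)
  ultimately show ?thesis by (metis exp_le_cancel_iff)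
qed

text \<open>The left side is the 32nd root of \<open>(dconst / 2)\<^sup>2\<close>, so it is enough
  to compare 32nd powers.\<close>

lemma exp_le_Cconst: "exp (ln (dconst / 2) / 16) \<le> Cconst"
proof -
  note d = dconst_pos
  have e: "eps 3 powr (3 / 2) \<ge> dconst * (1 / 2)"
  proof -
    have "(1 / 2 :: real) = sqrt (1 / 4)" by (simp add: real_sqrt_divide)
    also have "\<dots> \<le> sqrt (eps 3)" using eps_3_ge by simp
    finally have "dconst * (1 / 2) \<le> eps 3 * sqrt (eps 3)"
      using dconst_le_eps_3 d by (intro mult_mono) auto
    also have "\<dots> = eps 3 powr 1 * eps 3 powr (1 / 2)"
      using eps_3_ge by (simp add: powr_half_sqrt)
    also have "\<dots> = eps 3 powr (1 + 1 / 2)" by (simp only: powr_add)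
    also have "\<dots> = eps 3 powr (3 / 2)" by simp
    finally show ?thesis .
  qed
  have r: "rho powr (1 / 4) \<ge> 25 / 36"
  proof -
    have "(25 / 36 :: real) = (25 / 36) powr 1" by simp
    also have "\<dots> \<le> (25 / 36) powr (1 / 4)" by (rule powr_mono') auto
    also have "\<dots> \<le> rho powr (1 / 4)" using rho_ge by (intro powr_mono2) auto
    finally show ?thesis .
  qed
  \<comment> \<open>The constants are 3/4 times 1/2 times 25/36, which is 25/96, just above 1/4 =
    24/96.\<close>
  have "(dconst / 2)\<^sup>2 \<le> 3 / 4 * (dconst * (1 / 2)) * dconst * (25 / 36)"
    using d by (simp add: power2_eq_square field_simps)
  also have "\<dots> \<le> 3 / 4 * eps 3 powr (3 / 2) * dconst * rho powr (1 / 4)"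
    using d e r by (intro mult_mono mult_left_mono mult_right_mono) auto
  finally have "((dconst / 2)\<^sup>2) powr (1 / 32) \<le> Cconst"
    unfolding Cconst_def by (intro powr_mono2) auto
  moreover have "((dconst / 2)\<^sup>2) powr (1 / 32) = exp (ln (dconst / 2) / 16)"
    using d by (simp add: powr_def ln_realpow)
  ultimately show ?thesis by simp
qed

theorem theorem1:
  shows "\<exists>\<delta> :: nat \<Rightarrow> real. \<delta> \<longlonglongrightarrow> 0 \<and>
           (\<forall>k\<ge>1. ln (eps k) \<le> 2 ^ k * ln (Cconst + \<delta> k))"
proof -
  \<comment> \<open>The smallest nonnegative correction that makes the inequality true; what remains
    is its convergence to 0.\<close>
  define \<delta> where "\<delta> k = max 0 (exp (ln (eps k) / 2 ^ k) - Cconst)" for k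
  \<comment> \<open>The logarithm of the bound in \<open>eps_bounds\<close>, divided by 2^k, with m
    = k - 4; the 16 is 2^k / 2^m.\<close>
  define r where "r k = (ln (2 * eps 3 / dconst) + (real k - 4) * ln 2) / 2 ^ k + ln (dconst / 2) / 16" for k
  note d = dconst_pos
  have e3: "eps 3 > 0" using eps_3_ge by linarith
  have le: "\<delta> k \<le> max 0 (exp (r k) - Cconst)" if k: "k \<ge> 4" for k
  proof -
    define m where "m = k - 4"
    have km: "k = m + 4" using k by (simp add: m_def)
    \<comment> \<open>Raising the exponent to 2^m costs the factor \<open>2 / dconst\<close>, which
      enters the constant \<open>2 * eps 3 / dconst\<close>.\<close>
    have "(dconst / 2) ^ (2 ^ m - 1) = (dconst / 2) ^ 2 ^ m * (2 / dconst)"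
      using d power_Suc2[of "dconst / 2" "2 ^ m - 1"] by simp
    then have "eps k \<le> 2 * eps 3 / dconst * (2 ^ m * (dconst / 2) ^ 2 ^ m)"
      using eps_bounds(2)[of m] by (simp add: km mult_ac)
    then have "ln (eps k) \<le> ln (2 * eps 3 / dconst * (2 ^ m * (dconst / 2) ^ 2 ^ m))"
      using eps_bounds(1)[of m] by (simp add: km)
    also have "\<dots> = ln (2 * eps 3 / dconst) + ln (2 ^ m * (dconst / 2) ^ 2 ^ m)"
      by (rule ln_mult_pos) (use e3 d in auto)
    also have "ln (2 ^ m * (dconst / 2) ^ 2 ^ m) = ln (2 ^ m) + ln ((dconst / 2) ^ 2 ^ m)"
      by (rule ln_mult_pos) (use d in auto)
    also have "\<dots> = real m * ln 2 + 2 ^ m * ln (dconst / 2)"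
      using d by (simp add: ln_realpow)
    finally have "ln (eps k) / 2 ^ k \<le>
        (ln (2 * eps 3 / dconst) + (real m * ln 2 + 2 ^ m * ln (dconst / 2))) / 2 ^ k"
      by (rule divide_right_mono) simp
    also have "\<dots> = r k"
      by (simp add: r_def km power_add add_divide_distrib)
    finally have "exp (ln (eps k) / 2 ^ k) \<le> exp (r k)" by simp
    then show ?thesis unfolding \<delta>_def by (intro max.mono) auto
  qed
  have "(\<lambda>k. (ln (2 * eps 3 / dconst) + (real k - 4) * ln 2) / 2 ^ k) \<longlonglongrightarrow> 0"
    by real_asymp
  then have "r \<longlonglongrightarrow> 0 + ln (dconst / 2) / 16"
    unfolding r_def by (intro tendsto_intros)
  then have "(\<lambda>k. max 0 (exp (r k) - Cconst)) \<longlonglongrightarrow> max 0 (exp (0 + ln (dconst / 2) / 16) - Cconst)"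
    by (intro tendsto_intros)
  \<comment> \<open>By \<open>exp_le_Cconst\<close> the limit inside the maximum is at most 0, so
    the maximum tends to 0.\<close>
  then have lim: "(\<lambda>k. max 0 (exp (r k) - Cconst)) \<longlonglongrightarrow> 0"
    using exp_le_Cconst by (simp add: max_def split: if_splits)
  have "\<delta> \<longlonglongrightarrow> 0"
  proof (rule tendsto_sandwich[OF _ _ tendsto_const lim])
    show "\<forall>\<^sub>F k in sequentially. 0 \<le> \<delta> k" by (simp add: \<delta>_def)
    show "\<forall>\<^sub>F k in sequentially. \<delta> k \<le> max 0 (exp (r k) - Cconst)"
      using eventually_ge_at_top[of 4] by eventually_elim (rule le)
  qed
  \<comment> \<open>This follows from the choice of \<open>\<delta>\<close> alone, also for k <
    4.\<close>
  moreover have "ln (eps k) \<le> 2 ^ k * ln (Cconst + \<delta> k)" for k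
  proof -
    have "exp (ln (eps k) / 2 ^ k) \<le> Cconst + \<delta> k" by (simp add: \<delta>_def)
    then have "ln (eps k) / 2 ^ k \<le> ln (Cconst + \<delta> k)"
      by (metis exp_gt_zero ln_exp ln_mono)
    then show ?thesis by (simp add: divide_le_eq mult.commute)
  qed
  ultimately show ?thesis by blast
qed

end
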